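(* Let $\mathcal{B}=\{e_k\}_{k=1}^\infty$ be a seminormalized quasi-greedy basis of a real Banach space $\mathbb{B}$, and let $K$ be the quasi-greedy constant of $\mathcal{B}$. Then there is a constant $C>0$, independent of $N$ and $x$, such that for all $N=1,2,3,\dots$, all $x\in\mathbb{B}$ and every choice of greedy ordering $\pi$ of $x$, $$\|x-G_N(x)\|_{\mathbb{B}} \le C\, 8K^5\Big(\sum_{k=1}^N \mu(k)\frac{1}{k}\Big)\sigma_N(x).$$
   Context: $\mathcal B=\{e_k\}$ is a (Schauder) basis of $\mathbb B$ that is seminormalized, i.e. $0<\inf_k\|e_k\|\le\sup_k\|e_k\|<\infty$; each $x\in\mathbb B$ has a unique expansion $x=\sum_k a_k(x)e_k$. $\Sigma_N$ is the set of $y\in\mathbb B$ with at most $N$ nonzero coefficients, and $\sigma_N(x)=\inf_{y\in\Sigma_N}\|x-y\|_{\mathbb B}$. For $x\in\mathbb B$, a greedy ordering is a bijection $\pi$ of $\mathbb N$ with $|a_{\pi(k)}(x)|\ge|a_{\pi(k+1)}(x)|$ for all $k$, and $G_N(x)=\sum_{k=1}^N a_{\pi(k)}(x)e_{\pi(k)}$. The basis is quasi-greedy if $G_N(x)\to x$ for all $x$; its quasi-greedy constant $K$ is the least constant with $\|G_N(x)\|\le K\|x\|$ and $\|x-G_N(x)\|\le K\|x\|$ for all $x$, $N$ (and all greedy orderings). Democracy functions: $h_r(N)=\sup_{|\Gamma|=N}\|\sum_{k\in\Gamma}e_k\|$, $h_l(N)=\inf_{|\Gamma|=N}\|\sum_{k\in\Gamma}e_k\|$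 (over subsets $\Gamma\subset\mathbb N$ of cardinality $N$), and $\mu(N)=\sup_{1\le k\le N} h_r(k)/h_l(k)$. *)

theory Defs
  imports "HOL-Analysis.Analysis"
begin

text \<open>Basis vectors are indexed by nat (index 0 plays the role of the paper's index 1).\<close>

definition schauder_basis :: "(nat \<Rightarrow> 'a::banach) \<Rightarrow> bool" where
  "schauder_basis e \<longleftrightarrow> (\<forall>x. \<exists>!c::nat \<Rightarrow> real. (\<lambda>k. c k *\<^sub>R e k) sums x)"

definition seminormalized :: "(nat \<Rightarrow> 'a::real_normed_vector) \<Rightarrow> bool" where
  "seminormalized e \<longleftrightarrow> (\<exists>c d. 0 < c \<and> (\<forall>k. c \<le> norm (e k) \<and> norm (e k) \<le> d))"

definition coeff :: "(nat \<Rightarrow> 'a::banach) \<Rightarrow> nat \<Rightarrow> 'a \<Rightarrow> real" where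
  "coeff e k x = (THE c::nat \<Rightarrow> real. (\<lambda>j. c j *\<^sub>R e j) sums x) k"

definition greedy_ordering :: "(nat \<Rightarrow> 'a::banach) \<Rightarrow> 'a \<Rightarrow> (nat \<Rightarrow> nat) \<Rightarrow> bool" where
  "greedy_ordering e x \<pi> \<longleftrightarrow> bij \<pi> \<and>
     (\<forall>k. \<bar>coeff e (\<pi> k) x\<bar> \<ge> \<bar>coeff e (\<pi> (Suc k)) x\<bar>)"

definition greedy_approx :: "(nat \<Rightarrow> 'a::banach) \<Rightarrow> (nat \<Rightarrow> nat) \<Rightarrow> nat \<Rightarrow> 'a \<Rightarrow> 'a" where
  "greedy_approx e \<pi> N x = (\<Sum>k<N. coeff e (\<pi> k) x *\<^sub>R e (\<pi> k))"

definition quasi_greedy :: "(nat \<Rightarrow> 'a::banach) \<Rightarrow> bool" where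
  "quasi_greedy e \<longleftrightarrow> (\<forall>x \<pi>. greedy_ordering e x \<pi> \<longrightarrow>
      (\<lambda>N. greedy_approx e \<pi> N x) \<longlonglongrightarrow> x)"

definition qg_constant :: "(nat \<Rightarrow> 'a::banach) \<Rightarrow> real" where
  "qg_constant e = Inf {K. \<forall>x \<pi> N. greedy_ordering e x \<pi> \<longrightarrow>
      norm (greedy_approx e \<pi> N x) \<le> K * norm x \<and>
      norm (x - greedy_approx e \<pi> N x) \<le> K * norm x}"

definition h_r :: "(nat \<Rightarrow> 'a::real_normed_vector) \<Rightarrow> nat \<Rightarrow> real" where
  "h_r e N = Sup {norm (\<Sum>k\<in>\<Gamma>. e k) | \<Gamma>. finite \<Gamma> \<and> card \<Gamma> = N}"

definition h_l :: "(nat \<Rightarrow> 'a::real_normed_vector) \<Rightarrow> nat \<Rightarrow> real" where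
  "h_l e N = Inf {norm (\<Sum>k\<in>\<Gamma>. e k) | \<Gamma>. finite \<Gamma> \<and> card \<Gamma> = N}"

definition mu :: "(nat \<Rightarrow> 'a::real_normed_vector) \<Rightarrow> nat \<Rightarrow> real" where
  "mu e N = Max {h_r e k / h_l e k | k. 1 \<le> k \<and> k \<le> N}"

definition sigma :: "(nat \<Rightarrow> 'a::banach) \<Rightarrow> nat \<Rightarrow> 'a \<Rightarrow> real" where
  "sigma e N x = Inf {norm (x - y) | y. finite {k. coeff e k y \<noteq> 0} \<and> card {k. coeff e k y \<noteq> 0} \<le> N}"

end

theory Submission
  imports Defs
begin

text \<open>
  Let \<open>S\<close> be the sum of \<open>mu e k / k\<close> over \<open>1 \<le> k \<le> N\<close>, let \<open>A\<close> be the greedy set of \<open>x\<close>, let \<open>B\<close>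
  (with at most \<open>N\<close> elements) be the support of a competitor \<open>y\<close>, put \<open>z = x - y\<close>, and let \<open>P D\<close>
  be the coordinate projection onto \<open>D\<close>. Then \<open>x - P A x = z - P A z - P (B - A) z + P (B - A) x\<close>,
  so it suffices to bound each projection by a multiple of \<open>S * norm z\<close>.

  Uniform boundedness of greedy projections gives \<open>t * h_l e (card D) \<le> c * norm z\<close> whenever
  \<open>\<bar>coeff e k z\<bar> \<ge> t\<close> on \<open>D\<close>. On the other side, an expansion supported on at most \<open>N\<close> indices
  is split off in halves, largest coefficients first; each piece is controlled by \<open>h_r\<close>, hence by
  \<open>mu\<close> times the lower bound above, and the pieces add up to \<open>S\<close>. The term \<open>P (B - A) x\<close> is
  reached because its coefficients are dominated by those of \<open>z\<close> on \<open>A - B\<close>, a set at least as large.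

  Quasi-greediness is assumed only as convergence, so the uniform bound is obtained by a gliding
  hump, which in turn needs the basis constant (Baire category and successive approximation).
  As the constant may depend on the basis, the power of the quasi-greedy constant only
  enters through \<open>qg_constant e \<ge> 1\<close>.
\<close>

text \<open>\<open>A\<close> and its complement are sorted separately by decreasing modulus; since
  \<open>A\<close> dominates, the concatenation is sorted and \<open>A\<close> fills its first
  \<open>card A\<close> places. This turns a greedy set into an initial segment of an
  ordering.\<close>

lemma decreasing_arrangement:
  fixes c :: "nat \<Rightarrow> real"
  assumes A: "A \<subseteq> {M..<M'}" and g: "\<And>i j. i \<in> A \<Longrightarrow> j \<in> {M..<M'} - A \<Longrightarrow> \<bar>c j\<bar> \<le> \<bar>c i\<bar>"
  shows "\<exists>p. bij_betw p {M..<M'} {M..<M'} \<and> p ` {M..<M + card A} = A \<and>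
     (\<forall>k. M \<le> k \<longrightarrow> Suc k < M' \<longrightarrow> \<bar>c (p (Suc k))\<bar> \<le> \<bar>c (p k)\<bar>)"
proof -
  \<comment> \<open>The sign makes the increasing \<open>sort_key\<close> arrange by decreasing
    modulus.\<close>
  define f where "f k = - \<bar>c k\<bar>" for k
  have fA: "finite A" using A finite_subset by blast
  define xs where "xs = sort_key f (sorted_list_of_set A)"
  define ys where "ys = sort_key f (sorted_list_of_set ({M..<M'} - A))"
  define zs where "zs = xs @ ys"
  have xs: "set xs = A" "length xs = card A" "distinct xs" and ys: "set ys = {M..<M'} - A" "distinct ys"
    using fA by (simp_all add: xs_def ys_def)
  have zs: "set zs = {M..<M'}" "distinct zs" using xs ys A by (auto simp: zs_def)
  then have len: "length zs = M' - M" using distinct_card[of zs] by simp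
  have sorted: "sorted (map f zs)"
    using g xs ys by (auto simp: zs_def sorted_append f_def xs_def ys_def)
  define p where "p k = zs ! (k - M)" for k
  have sh: "bij_betw (\<lambda>k. k - M) {M..<M + n} {..<n}" for n
    by (rule bij_betwI[where g = "\<lambda>k. k + M"]) auto
  have "bij_betw (\<lambda>k. k - M) {M..<M'} {..<length zs}"
    using sh[of "M' - M"] len by (cases "M \<le> M'") (auto simp: bij_betw_def)
  then have "bij_betw p {M..<M'} {M..<M'}"
    using bij_betw_trans[OF _ bij_betw_nth[OF zs(2) refl zs(1)[symmetric]]]
    by (simp add: p_def[abs_def] comp_def)
  moreover have "p ` {M..<M + card A} = A"
  proof -
    have "p ` {M..<M + card A} = (\<lambda>k. zs ! k) ` ((\<lambda>k. k - M) ` {M..<M + card A})"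
      by (simp add: p_def[abs_def] image_image)
    also have "\<dots> = (\<lambda>k. zs ! k) ` {..<card A}" using sh by (simp add: bij_betw_def)
    also have "\<dots> = (\<lambda>k. xs ! k) ` {..<length xs}"
      using xs by (intro image_cong) (auto simp: zs_def nth_append)
    also have "\<dots> = A" using xs by (auto simp: set_conv_nth)
    finally show ?thesis .
  qed
  moreover have "\<bar>c (p (Suc k))\<bar> \<le> \<bar>c (p k)\<bar>" if "M \<le> k" "Suc k < M'" for k
  proof -
    have "map f zs ! (k - M) \<le> map f zs ! (Suc k - M)"
      using that len by (intro sorted_nth_mono[OF sorted]) auto
    then show ?thesis using that len by (simp add: p_def f_def)
  qed
  ultimately show ?thesis by blast
qed

section \<open>Coefficients and finite expansions\<close>

locale seminormalized_basis =
  fixes e :: "nat \<Rightarrow> 'a::banach"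
  assumes basis: "schauder_basis e" and seminorm: "seminormalized e"
begin

text \<open>For \<open>c = cf x\<close> this is the coordinate projection \<open>P A x\<close>.
  Keeping the coefficients apart from the set lets one sequence be restricted to many sets.\<close>

definition lincomb :: "(nat \<Rightarrow> real) \<Rightarrow> nat set \<Rightarrow> 'a" where
  "lincomb c A = (\<Sum>k\<in>A. c k *\<^sub>R e k)"

abbreviation cf :: "'a \<Rightarrow> nat \<Rightarrow> real" where "cf x \<equiv> \<lambda>k. coeff e k x"

lemma cf_sums: "(\<lambda>k. cf x k *\<^sub>R e k) sums x"
proof -
  have "\<exists>!c. (\<lambda>k. c k *\<^sub>R e k) sums x" using basis by (simp add: schauder_basis_def)
  from theI'[OF this] show ?thesis by (simp add: coeff_def)
qed

lemma cf_eqI: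
  assumes "(\<lambda>k. c k *\<^sub>R e k) sums x" shows "cf x = c"
proof -
  have "\<exists>!c. (\<lambda>k. c k *\<^sub>R e k) sums x" using basis by (simp add: schauder_basis_def)
  from the1_equality[OF this, OF assms] show ?thesis by (simp add: coeff_def)
qed

lemma partial_tendsto: "(\<lambda>n. lincomb (cf x) {..<n}) \<longlonglongrightarrow> x"
  using cf_sums[of x] by (simp add: sums_def lincomb_def)

lemma cf_diff: "cf (x - y) k = cf x k - cf y k"
proof -
  have "cf (x - y) = (\<lambda>k. cf x k - cf y k)"
    using sums_diff[OF cf_sums[of x] cf_sums[of y]] by (intro cf_eqI) (simp add: algebra_simps)
  from fun_cong[OF this] show ?thesis .
qed

lemma cf_scale: "cf (r *\<^sub>R x) k = r * cf x k"
proof -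
  have "cf (r *\<^sub>R x) = (\<lambda>k. r * cf x k)"
    using bounded_linear.sums[OF bounded_linear_scaleR_right cf_sums[of x], of r]
    by (intro cf_eqI) (simp add: algebra_simps)
  from fun_cong[OF this] show ?thesis .
qed

lemma cf_lincomb:
  assumes "finite A" shows "cf (lincomb c A) k = (if k \<in> A then c k else 0)"
proof -
  have "(\<lambda>k. (if k \<in> A then c k else 0) *\<^sub>R e k) sums
        (\<Sum>k\<in>A. (if k \<in> A then c k else 0) *\<^sub>R e k)"
    by (rule sums_finite[OF assms]) auto
  then have "cf (lincomb c A) = (\<lambda>k. if k \<in> A then c k else 0)"
    by (intro cf_eqI) (simp add: lincomb_def)
  from fun_cong[OF this] show ?thesis .
qed

lemma lincomb_Un_disjoint:
  "\<lbrakk>finite A; finite B; A \<inter> B = {}\<rbrakk> \<Longrightarrow> lincomb c (A \<union> B) = lincomb c A + lincomb c B"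
  by (simp add: lincomb_def sum.union_disjoint)

lemma lincomb_Diff: "\<lbrakk>finite B; A \<subseteq> B\<rbrakk> \<Longrightarrow> lincomb c (B - A) = lincomb c B - lincomb c A"
  by (simp add: lincomb_def sum_diff)

lemma lincomb_scale: "lincomb (\<lambda>k. r * c k) A = r *\<^sub>R lincomb c A"
  by (simp add: lincomb_def scaleR_sum_right)

lemma lincomb_diff: "lincomb (\<lambda>k. c k - d k) A = lincomb c A - lincomb d A"
  by (simp add: lincomb_def scaleR_diff_left sum_subtractf)

lemma lincomb_cong: "(\<And>k. k \<in> A \<Longrightarrow> c k = d k) \<Longrightarrow> lincomb c A = lincomb d A"
  by (simp add: lincomb_def)

lemma lincomb_empty [simp]: "lincomb c {} = 0"
  by (simp add: lincomb_def)

lemma partial_scale: "lincomb (cf (r *\<^sub>R x)) A = r *\<^sub>R lincomb (cf x) A"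
  by (simp add: cf_scale lincomb_scale)

lemma partial_diff: "lincomb (cf (x - y)) A = lincomb (cf x) A - lincomb (cf y) A"
  by (simp add: cf_diff lincomb_diff)

lemma norm_e_bounds: "\<exists>a b. 0 < a \<and> 0 < b \<and> (\<forall>k. a \<le> norm (e k) \<and> norm (e k) \<le> b)"
  using seminorm unfolding seminormalized_def by (meson less_le_trans)

section \<open>The basis constant\<close>

text \<open>By Baire category some \<open>E m\<close> is dense in a ball; symmetry and convexity of
  \<open>E m\<close> move the ball to the origin, and scaling reaches every \<open>x\<close>.
  Continuity of the coefficients is not yet available, so \<open>E m\<close> is not known to be
  closed and the bound is obtained only for a nearby \<open>y\<close>.\<close>

lemma partial_sums_bounded_dense:
  "\<exists>L>0. \<forall>x. \<forall>\<delta>>0. \<exists>y. norm (x - y) < \<delta> \<and> (\<forall>n. norm (lincomb (cf y) {..<n}) \<le> L * norm x)"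
proof -
  define E where "E m = {x. \<forall>n. norm (lincomb (cf x) {..<n}) \<le> real m}" for m :: nat
  have "\<exists>m. x \<in> E m" for x
  proof -
    have "Bseq (\<lambda>n. lincomb (cf x) {..<n})"
      using partial_tendsto convergent_imp_Bseq convergentI by blast
    then obtain r where "\<And>n. norm (lincomb (cf x) {..<n}) \<le> r" unfolding Bseq_def by blast
    moreover obtain m :: nat where "r \<le> real m" using real_arch_simple by blast
    ultimately show ?thesis unfolding E_def by (blast intro: order_trans)
  qed
  then have cover: "\<Union>(range (\<lambda>m. closure (E m))) = UNIV" using closure_subset by fast
  have "\<exists>m. interior (closure (E m)) \<noteq> {}"
  proof (rule ccontr)
    assume "\<nexists>m. interior (closure (E m)) \<noteq> {}"
    then have "euclidean interior_of \<Union>(range (\<lambda>m. closure (E m))) = {}"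
      using completely_metrizable_space_euclidean
      by (intro Baire_category_alt) auto
    with cover show False by simp
  qed
  then obtain m a r where r: "r > 0" "cball a r \<subseteq> closure (E m)"
    by (metis ex_in_conv mem_interior_cball)
  \<comment> \<open>Both \<open>a + u\<close> and \<open>a - u\<close> lie in the ball; half the
    difference of their approximants cancels the centre \<open>a\<close> and stays in
    \<open>E m\<close>.\<close>
  have ap: "\<exists>y\<in>E m. norm (u - y) < \<delta>" if "norm u \<le> r" "\<delta> > 0" for u \<delta>
  proof -
    have "a + u \<in> closure (E m)" "a - u \<in> closure (E m)"
      using r(2) that by (auto simp: dist_norm subset_iff)
    then have "\<exists>p\<in>E m. norm (p - (a + u)) < \<delta>" "\<exists>q\<in>E m. norm (q - (a - u)) < \<delta>"
      using \<open>\<delta> > 0\<close> unfolding closure_approachable dist_norm by simp_all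
    then obtain p q where p: "p \<in> E m" "norm (p - (a + u)) < \<delta>" and q: "q \<in> E m" "norm (q - (a - u)) < \<delta>"
      by auto
    have "norm (u - (1/2) *\<^sub>R (p - q)) = norm ((1/2) *\<^sub>R ((q - (a - u)) - (p - (a + u))))"
    proof -
      have "u - (1/2) *\<^sub>R (p - q) = (1/2) *\<^sub>R (2 *\<^sub>R u - (p - q))"
        by (simp add: scaleR_diff_right)
      also have "2 *\<^sub>R u - (p - q) = (q - (a - u)) - (p - (a + u))"
        by (simp add: scaleR_2)
      finally show ?thesis by simp
    qed
    also have "\<dots> < \<delta>" using norm_triangle_ineq4[of "q - (a - u)" "p - (a + u)"] p q by simp
    finally have "norm (u - (1/2) *\<^sub>R (p - q)) < \<delta>" .
    moreover have "(1/2) *\<^sub>R (p - q) \<in> E m"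
      unfolding E_def
    proof (intro CollectI allI)
      fix n
      have "norm (lincomb (cf p) {..<n} - lincomb (cf q) {..<n}) \<le> real m + real m"
        by (intro norm_triangle_le_diff add_mono) (use p q in \<open>simp_all add: E_def\<close>)
      then show "norm (lincomb (cf ((1/2) *\<^sub>R (p - q))) {..<n}) \<le> m"
        unfolding partial_scale partial_diff norm_scaleR by simp
    qed
    ultimately show ?thesis by blast
  qed
  have zero: "lincomb (cf 0) A = 0" for A using partial_scale[of 0 0 A] by simp
  have "\<exists>y. norm (x - y) < \<delta> \<and> (\<forall>n. norm (lincomb (cf y) {..<n}) \<le> ((m + 1) / r) * norm x)"
    if "\<delta> > 0" for x \<delta>
  proof (cases "x = 0")
    case True then show ?thesis using that zero by (intro exI[of _ 0]) auto
  next
    case False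
    define s where "s = r / norm x"
    have s: "s > 0" using False r by (simp add: s_def)
    have "norm (s *\<^sub>R x) \<le> r" "0 < s * \<delta>" using False r s that by (simp_all add: s_def)
    from ap[OF this] obtain y where y: "y \<in> E m" "norm (s *\<^sub>R x - y) < s * \<delta>" by blast
    have "s *\<^sub>R (x - (1/s) *\<^sub>R y) = s *\<^sub>R x - y" using s by (simp add: scaleR_diff_right)
    then have "s * norm (x - (1/s) *\<^sub>R y) < s * \<delta>" using y s by (metis abs_of_pos norm_scaleR)
    then have "norm (x - (1/s) *\<^sub>R y) < \<delta>" using s by simp
    moreover have "norm (lincomb (cf ((1/s) *\<^sub>R y)) {..<n}) \<le> ((m + 1) / r) * norm x" for n
    proof -
      have "norm (lincomb (cf ((1/s) *\<^sub>R y)) {..<n}) = (norm x / r) * norm (lincomb (cf y) {..<n})"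
        using s r by (simp only: partial_scale norm_scaleR) (simp add: s_def)
      also have "\<dots> \<le> (norm x / r) * (m + 1)"
        using y r unfolding E_def by (intro mult_left_mono) (auto intro: order_trans)
      finally show ?thesis by (simp add: mult.commute)
    qed
    ultimately show ?thesis by blast
  qed
  then show ?thesis using r by (intro exI[of _ "(m + 1) / r"]) auto
qed

text \<open>Successive approximation writes \<open>x\<close> as a series of vectors
  \<open>y i\<close> whose partial sums are at most \<open>L * q i\<close>, a geometric sequence.
  Adding their expansions termwise gives an expansion of \<open>x\<close>; by uniqueness its
  coefficients are \<open>cf x\<close>, so the partial sums of \<open>x\<close> inherit the summed
  bound.\<close>

lemma partial_sums_uniformly_bounded:
  "\<exists>\<beta>\<ge>1. \<forall>x n. norm (lincomb (cf x) {..<n}) \<le> \<beta> * norm x"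
proof -
  obtain a b where ab: "0 < a" "\<And>k. a \<le> norm (e k)" using norm_e_bounds by blast
  obtain L g where L: "L > 0" and g: "\<And>x \<delta>. \<delta> > 0 \<Longrightarrow> norm (x - g x \<delta>) < \<delta>"
      "\<And>x \<delta> n. \<delta> > 0 \<Longrightarrow> norm (lincomb (cf (g x \<delta>)) {..<n}) \<le> L * norm x"
    using partial_sums_bounded_dense by metis
  have "norm (lincomb (cf x) {..<N}) \<le> (2 * L) * norm x" for x N
  proof (cases "x = 0")
    case True then show ?thesis using partial_scale[of 0 0] by simp
  next
    case False
    define q where "q i = norm x * (1/2) ^ i" for i :: nat
    have q: "q i > 0" for i using False by (simp add: q_def)
    \<comment> \<open>\<open>r i\<close> is the error left after \<open>i\<close> approximations;
      the tolerance \<open>q (Suc i)\<close> halves its bound at each turn.\<close>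
    define r where "r = rec_nat x (\<lambda>i z. z - g z (q (Suc i)))"
    define y where "y i = g (r i) (q (Suc i))" for i
    have r0: "r 0 = x" and rS: "r (Suc i) = r i - y i" for i by (simp_all add: r_def y_def)
    have rn: "norm (r i) \<le> q i" for i
    proof (cases i)
      case 0 then show ?thesis by (simp add: r0 q_def)
    next
      case (Suc j) then show ?thesis using g(1)[OF q[of "Suc j"], of "r j"] by (simp add: rS y_def)
    qed
    have P: "norm (lincomb (cf (y i)) {..<n}) \<le> L * q i" for i n
      using g(2)[OF q[of "Suc i"], of "r i" n] rn[of i] L
      by (metis y_def mult_left_mono less_imp_le order_trans)
    have qs: "q sums (norm x * 2)"
      unfolding q_def using sums_mult[OF geometric_sums[of "1/2::real"], of "norm x"] by simp
    have Lq: "summable (\<lambda>i. L * q i)" using qs by (simp add: summable_mult sums_summable)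
    have q0: "q \<longlonglongrightarrow> 0" using qs sums_summable summable_LIMSEQ_zero by blast
    have "(\<Sum>i<n. y i) = x - r n" for n by (induction n) (auto simp: r0 rS)
    moreover have "r \<longlonglongrightarrow> 0" by (rule Lim_null_comparison[OF _ q0]) (simp add: rn)
    ultimately have ysum: "y sums x" unfolding sums_def using tendsto_diff[OF tendsto_const, of r 0 _ x] by simp
    have Ps: "summable (\<lambda>i. lincomb (cf (y i)) {..<n})" for n
      by (rule summable_comparison_test[OF _ Lq]) (simp add: P)
    define T where "T n = (\<Sum>i. lincomb (cf (y i)) {..<n})" for n
    \<comment> \<open>One coefficient is a difference of two consecutive partial sums, and
      \<open>norm (e k)\<close> is at least \<open>a\<close>. This makes the series for the limit
      coefficients \<open>d\<close> converge.\<close>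
    have cb: "\<bar>cf (y i) k\<bar> \<le> (2 * L / a) * q i" for i k
    proof -
      have "\<bar>cf (y i) k\<bar> * a \<le> \<bar>cf (y i) k\<bar> * norm (e k)" using ab by (intro mult_left_mono) auto
      also have "\<dots> = norm (lincomb (cf (y i)) {..<Suc k} - lincomb (cf (y i)) {..<k})"
        by (simp add: lincomb_def)
      also have "\<dots> \<le> L * q i + L * q i" by (rule order_trans[OF norm_triangle_ineq4]) (intro add_mono P)
      finally show ?thesis using ab by (simp add: field_simps)
    qed
    have cs: "summable (\<lambda>i. cf (y i) k)" for k
      by (rule summable_comparison_test[of _ "\<lambda>i. (2 * L / a) * q i"])
         (use cb in \<open>auto intro!: summable_mult sums_summable[OF qs]\<close>)
    define d where "d k = (\<Sum>i. cf (y i) k)" for k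
    have Td: "T n = lincomb d {..<n}" for n
    proof -
      have "(\<lambda>i. \<Sum>k<n. cf (y i) k *\<^sub>R e k) sums (\<Sum>k<n. d k *\<^sub>R e k)"
        unfolding d_def
        by (intro sums_sum bounded_linear.sums[OF bounded_linear_scaleR_left] summable_sums cs)
      then show ?thesis by (simp add: T_def lincomb_def sums_iff)
    qed
    have yb: "norm (y i) \<le> L * q i" for i
      by (rule LIMSEQ_le_const2[OF tendsto_norm[OF partial_tendsto]]) (use P in blast)
    have db: "norm (y i - lincomb (cf (y i)) {..<n}) \<le> 2 * (L * q i)" for i n
      using norm_triangle_ineq4[of "y i" "lincomb (cf (y i)) {..<n}"] yb[of i] P[of i n] by simp
    have Lq2: "summable (\<lambda>i. 2 * (L * q i))" using Lq by (rule summable_mult)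
    \<comment> \<open>Tannery's theorem exchanges the limit in \<open>n\<close> with the sum over
      \<open>i\<close>, the dominating series being geometric.\<close>
    have "(\<lambda>n. \<Sum>i. norm (y i - lincomb (cf (y i)) {..<n})) \<longlonglongrightarrow> (\<Sum>i. 0::real)"
    proof (rule tannerys_theorem[OF _ _ Lq2, THEN conjunct2, THEN conjunct2])
      show "(\<lambda>n. norm (y i - lincomb (cf (y i)) {..<n})) \<longlonglongrightarrow> 0" for i
        using tendsto_norm[OF tendsto_diff[OF tendsto_const partial_tendsto[of "y i"]], of "y i"] by simp
      show "\<forall>\<^sub>F (k, n) in sequentially \<times>\<^sub>F sequentially.
          norm (norm (y k - lincomb (cf (y k)) {..<n})) \<le> 2 * (L * q k)"
        using db by (intro always_eventually) auto
    qed simp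
    then have lim0: "(\<lambda>n. \<Sum>i. norm (y i - lincomb (cf (y i)) {..<n})) \<longlonglongrightarrow> 0" by simp
    have "norm (T n - x) \<le> (\<Sum>i. norm (y i - lincomb (cf (y i)) {..<n}))" for n
    proof -
      have "(\<lambda>i. y i - lincomb (cf (y i)) {..<n}) sums (x - T n)"
        unfolding T_def by (intro sums_diff ysum summable_sums Ps)
      moreover have "summable (\<lambda>i. norm (y i - lincomb (cf (y i)) {..<n}))"
        by (rule summable_comparison_test[OF _ Lq2]) (use db in auto)
      ultimately show ?thesis by (metis norm_minus_commute sums_unique summable_norm)
    qed
    then have "(\<lambda>n. T n - x) \<longlonglongrightarrow> 0"
      by (intro Lim_null_comparison[OF _ lim0]) simp
    then have "T \<longlonglongrightarrow> x" by (rule LIM_zero_cancel)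
    then have "d = cf x"
      by (intro cf_eqI[symmetric]) (simp add: Td[abs_def, unfolded lincomb_def] sums_def)
    then have "norm (lincomb (cf x) {..<N}) = norm (T N)" by (simp add: Td)
    also have "\<dots> \<le> (\<Sum>i. L * q i)" unfolding T_def
      by (rule norm_suminf_le[OF _ Lq]) (rule P)
    also have "\<dots> = 2 * L * norm x" using sums_mult[OF qs, of L] by (simp add: sums_iff)
    finally show ?thesis .
  qed
  then have "norm (lincomb (cf x) {..<n}) \<le> max 1 (2 * L) * norm x" for x n
    by (meson max.cobounded2 mult_right_mono norm_ge_zero order_trans)
  then show ?thesis by (intro exI[of _ "max 1 (2 * L)"]) auto
qed

lemma lincomb_one: "lincomb (\<lambda>_. 1) A = (\<Sum>k\<in>A. e k)"
  by (simp add: lincomb_def)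

lemma coefficients_bounded: "\<exists>B>0. \<forall>x k. \<bar>cf x k\<bar> \<le> B * norm x"
proof -
  obtain a b where ab: "0 < a" "\<And>k. a \<le> norm (e k)" using norm_e_bounds by blast
  obtain \<beta> where \<beta>: "\<beta> \<ge> 1" "\<And>x n. norm (lincomb (cf x) {..<n}) \<le> \<beta> * norm x"
    using partial_sums_uniformly_bounded by blast
  have "\<bar>cf x k\<bar> \<le> (2 * \<beta> / a) * norm x" for x k
  proof -
    have "\<bar>cf x k\<bar> * a \<le> \<bar>cf x k\<bar> * norm (e k)" using ab by (intro mult_left_mono) auto
    also have "\<dots> = norm (lincomb (cf x) {..<Suc k} - lincomb (cf x) {..<k})"
      by (simp add: lincomb_def)
    also have "\<dots> \<le> \<beta> * norm x + \<beta> * norm x"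
      by (rule order_trans[OF norm_triangle_ineq4]) (intro add_mono \<beta>)
    finally show ?thesis using ab by (simp add: field_simps)
  qed
  then show ?thesis using ab \<beta>(1) by (intro exI[of _ "2 * \<beta> / a"]) auto
qed

section \<open>Democracy functions and the growth of \<open>mu_sum\<close>\<close>

lemma h_l_le: "finite A \<Longrightarrow> h_l e (card A) \<le> norm (\<Sum>k\<in>A. e k)"
  unfolding h_l_def by (rule cInf_lower) (auto intro!: bdd_belowI[of _ 0])

lemma h_r_ge:
  assumes "finite A" shows "norm (\<Sum>k\<in>A. e k) \<le> h_r e (card A)"
proof -
  obtain b where b: "0 < b" "\<And>k. norm (e k) \<le> b" using norm_e_bounds by blast
  have "norm (\<Sum>k\<in>G. e k) \<le> real (card A) * b" if "finite G" "card G = card A" for G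
    using sum_norm_le[of G e "\<lambda>_. b"] b that by simp
  then show ?thesis unfolding h_r_def using assms
    by (intro cSup_upper bdd_aboveI[of _ "real (card A) * b"]) auto
qed

text \<open>A nonempty sum of basis vectors has a coefficient equal to 1, so
  \<open>coefficients_bounded\<close> keeps its norm above \<open>1 / B\<close>. This justifies
  dividing by \<open>h_l\<close>.\<close>

lemma h_l_pos:
  assumes "n \<ge> 1" shows "h_l e n > 0"
proof -
  obtain B where B: "B > 0" "\<And>x k. \<bar>cf x k\<bar> \<le> B * norm x" using coefficients_bounded by blast
  have "1 / B \<le> h_l e n" unfolding h_l_def
  proof (rule cInf_greatest)
    show "{norm (\<Sum>k\<in>A. e k) |A. finite A \<and> card A = n} \<noteq> {}"
      using card_lessThan[of n] by blast
  next
    fix r assume "r \<in> {norm (\<Sum>k\<in>A. e k) |A. finite A \<and> card A = n}"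
    then obtain A where A: "finite A" "card A = n" "r = norm (lincomb (\<lambda>_. 1) A)"
      by (auto simp: lincomb_one)
    then obtain k where "k \<in> A" using assms by fastforce
    then have "1 \<le> B * r" using B(2)[of k "lincomb (\<lambda>_. 1) A"] A by (simp add: cf_lincomb)
    then show "1 / B \<le> r" using B by (simp add: field_simps)
  qed
  then show ?thesis using B by (meson less_le_trans zero_less_divide_1_iff)
qed

lemma h_l_le_h_r: "h_l e n \<le> h_r e n"
  using h_l_le[of "{..<n}"] h_r_ge[of "{..<n}"] by simp

lemma ratio_le_mu: "\<lbrakk>1 \<le> k; k \<le> n\<rbrakk> \<Longrightarrow> h_r e k / h_l e k \<le> mu e n"
  unfolding mu_def by (rule Max_ge) auto

lemma mu_mono: "\<lbrakk>1 \<le> m; m \<le> n\<rbrakk> \<Longrightarrow> mu e m \<le> mu e n"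
  unfolding mu_def by (rule Max_mono) (auto intro: exI[of _ m] order_trans)

lemma mu_ge_1:
  assumes "n \<ge> 1" shows "1 \<le> mu e n"
proof -
  have "1 \<le> h_r e 1 / h_l e 1" using h_l_le_h_r[of 1] h_l_pos[of 1] by simp
  also have "\<dots> \<le> mu e n" by (rule ratio_le_mu) (use assms in auto)
  finally show ?thesis .
qed

definition mu_sum :: "nat \<Rightarrow> real" where
  "mu_sum n = (\<Sum>k=1..n. mu e k * (1 / real k))"

lemma mu_sum_mono: "m \<le> n \<Longrightarrow> mu_sum m \<le> mu_sum n"
  unfolding mu_sum_def
  by (rule sum_mono2) (auto intro!: divide_nonneg_nonneg order_trans[OF zero_le_one mu_ge_1])

lemma mu_sum_ge_1: "n \<ge> 1 \<Longrightarrow> 1 \<le> mu_sum n"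
  using mu_sum_mono[of 1 n] mu_ge_1[of 1] by (simp add: mu_sum_def)

text \<open>At least \<open>n / 2\<close> indices \<open>k\<close> satisfy
  \<open>m < k \<le> n\<close>, and each contributes at least \<open>mu e m / n\<close>. The gain
  pays for one halving step in \<open>lincomb_le_mu_sum\<close>.\<close>

lemma mu_sum_doubling:
  assumes "1 \<le> m" "2 * m \<le> n" shows "mu_sum m + mu e m / 2 \<le> mu_sum n"
proof -
  have "{1..n} = {1..m} \<union> {Suc m..n}" using assms by auto
  then have "mu_sum n = mu_sum m + (\<Sum>k=Suc m..n. mu e k * (1 / real k))"
    unfolding mu_sum_def by (simp add: sum.union_disjoint)
  moreover have "(\<Sum>k=Suc m..n. mu e m * (1 / real n)) \<le> (\<Sum>k=Suc m..n. mu e k * (1 / real k))"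
    using assms mu_ge_1 
    by (intro sum_mono mult_mono mu_mono divide_left_mono) (auto intro: order_trans[OF zero_le_one])
  moreover have "mu e m / 2 \<le> (\<Sum>k=Suc m..n. mu e m * (1 / real n))"
  proof -
    have "mu e m * (real n / 2) \<le> mu e m * real (n - m)"
      using assms mu_ge_1[of m] by (intro mult_left_mono) auto
    then show ?thesis using assms by (simp add: field_simps)
  qed
  ultimately show ?thesis by linarith
qed

section \<open>Upper bounds for finite expansions\<close>

text \<open>The multiplier \<open>m\<close> is a nonnegative combination of indicators of its level
  sets, with weights adding up to at most \<open>M\<close>. The induction peels off the lowest
  layer: subtracting the least positive value \<open>s\<close> removes at least one index from the
  support.\<close>

lemma layer_cake:
  assumes "finite G" "0 \<le> H" "\<And>s. s > 0 \<Longrightarrow> norm (lincomb c {i\<in>G. m i \<ge> s}) \<le> H"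
    and "0 \<le> M" "\<And>i. i \<in> G \<Longrightarrow> 0 \<le> m i \<and> m i \<le> M"
  shows "norm (lincomb (\<lambda>i. m i * c i) G) \<le> M * H"
  using assms(3-)
proof (induction "card {i\<in>G. m i > 0}" arbitrary: m M rule: less_induct)
  case less
  define S where "S = {i\<in>G. m i > 0}"
  have fS: "finite S" using assms(1) by (simp add: S_def)
  show ?case
  proof (cases "S = {}")
    case True
    then have "m i = 0" if "i \<in> G" for i using less.prems(3)[OF that] that unfolding S_def by force
    then have "lincomb (\<lambda>i. m i * c i) G = 0" by (simp add: lincomb_def)
    then show ?thesis using less.prems(2) assms(2) by simp
  next
    case False
    define s where "s = Min (m ` S)"
    have sin: "s \<in> m ` S" and smin: "\<And>i. i \<in> S \<Longrightarrow> s \<le> m i"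
      using fS False by (auto simp: s_def)
    then obtain i0 where i0: "i0 \<in> S" "m i0 = s" by auto
    have s: "s > 0" "s \<le> M" using i0 less.prems(3)[of i0] by (auto simp: S_def)
    have Ss: "S = {i\<in>G. m i \<ge> s}" using smin s by (auto simp: S_def)
    \<comment> \<open>The positive level sets of \<open>m'\<close> are those of \<open>m\<close>
      shifted by \<open>s\<close>, so the hypothesis on level sets survives.\<close>
    define m' where "m' i = (if i \<in> S then m i - s else 0)" for i
    have "lincomb (\<lambda>i. m i * c i) G = lincomb (\<lambda>i. m i * c i) S"
      unfolding lincomb_def
      by (rule sum.mono_neutral_right) (use assms(1) less.prems(3) in \<open>force simp: S_def\<close>)+
    also have "\<dots> = s *\<^sub>R lincomb c S + lincomb (\<lambda>i. m' i * c i) S"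
      by (simp add: lincomb_def scaleR_sum_right sum.distrib[symmetric] m'_def algebra_simps)
    also have "lincomb (\<lambda>i. m' i * c i) S = lincomb (\<lambda>i. m' i * c i) G"
      unfolding lincomb_def
      by (rule sum.mono_neutral_left) (use assms(1) in \<open>auto simp: S_def m'_def\<close>)
    finally have eq: "lincomb (\<lambda>i. m i * c i) G = s *\<^sub>R lincomb c S + lincomb (\<lambda>i. m' i * c i) G" .
    have "norm (lincomb (\<lambda>i. m' i * c i) G) \<le> (M - s) * H"
    proof (rule less.hyps)
      have "{i\<in>G. m' i > 0} \<subseteq> S - {i0}" using i0 by (auto simp: m'_def split: if_splits)
      then show "card {i\<in>G. m' i > 0} < card {i\<in>G. m i > 0}"
        using fS i0 unfolding S_def[symmetric]
        by (metis card_Diff1_less card_mono finite_Diff le_less_trans)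
    next
      fix t :: real assume t: "t > 0"
      then have "{i\<in>G. m' i \<ge> t} = {i\<in>G. m i \<ge> s + t}"
        using s by (auto simp: m'_def S_def)
      then show "norm (lincomb c {i\<in>G. m' i \<ge> t}) \<le> H" using less.prems(1)[of "s + t"] s t by simp
    next
      show "0 \<le> M - s" using s by simp
    next
      fix i assume "i \<in> G"
      then show "0 \<le> m' i \<and> m' i \<le> M - s"
        using less.prems(3)[of i] smin[of i] s by (auto simp: m'_def)
    qed
    moreover have "norm (s *\<^sub>R lincomb c S) \<le> s * H"
      using less.prems(1)[of s] s Ss by simp
    ultimately have "norm (lincomb (\<lambda>i. m i * c i) G) \<le> s * H + (M - s) * H"
      unfolding eq by (rule norm_triangle_mono[rotated])
    then show ?thesis by (simp add: algebra_simps)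
  qed
qed

text \<open>The layer cake argument applies to the positive and negative parts of \<open>b\<close>
  separately, whence the factor 2.\<close>

lemma lincomb_bounded_coefficients:
  assumes "finite D" "0 \<le> t" "\<And>i. i \<in> D \<Longrightarrow> \<bar>b i\<bar> \<le> t" "0 \<le> H"
    and H: "\<And>A. A \<subseteq> D \<Longrightarrow> norm (\<Sum>k\<in>A. e k) \<le> H"
  shows "norm (lincomb b D) \<le> 2 * (t * H)"
proof -
  have *: "norm (lincomb (\<lambda>i. m i * 1) D) \<le> t * H" if "\<And>i. i \<in> D \<Longrightarrow> 0 \<le> m i \<and> m i \<le> t" for m
    by (rule layer_cake) (use assms that in \<open>auto simp: lincomb_one\<close>)
  have "lincomb b D = lincomb (\<lambda>i. max (b i) 0 * 1) D - lincomb (\<lambda>i. max (- b i) 0 * 1) D"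
    unfolding lincomb_diff[symmetric] by (rule lincomb_cong) auto
  also have "norm \<dots> \<le> t * H + t * H"
    using assms(2,3) by (intro norm_triangle_le_diff add_mono *) (fastforce simp: abs_le_iff)+
  finally show ?thesis by (simp add: mult.commute)
qed

lemma exists_greedy_subset:
  fixes b :: "nat \<Rightarrow> real"
  assumes "finite G" "m \<le> card G"
  shows "\<exists>A\<subseteq>G. card A = m \<and> (\<forall>i\<in>A. \<forall>j\<in>G - A. \<bar>b j\<bar> \<le> \<bar>b i\<bar>)"
  using assms(2)
proof (induction m)
  case 0 then show ?case by (intro exI[of _ "{}"]) auto
next
  case (Suc m)
  then obtain A where A: "A \<subseteq> G" "card A = m" "\<forall>i\<in>A. \<forall>j\<in>G - A. \<bar>b j\<bar> \<le> \<bar>b i\<bar>" by auto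
  have fA: "finite A" using A assms finite_subset by blast
  have ne: "G - A \<noteq> {}" using A Suc.prems assms by auto
  have "Max ((\<lambda>j. \<bar>b j\<bar>) ` (G - A)) \<in> (\<lambda>j. \<bar>b j\<bar>) ` (G - A)"
    using ne assms by (intro Max_in) auto
  then obtain i where i: "i \<in> G - A" "\<bar>b i\<bar> = Max ((\<lambda>j. \<bar>b j\<bar>) ` (G - A))" by auto
  have "\<forall>j\<in>G - A. \<bar>b j\<bar> \<le> \<bar>b i\<bar>" using i assms by simp
  then show ?case using A i fA by (intro exI[of _ "insert i A"]) auto
qed

text \<open>For a subset of size \<open>j\<close>, \<open>t * h_r e j\<close> equals
  \<open>t * h_l e j\<close> times the ratio \<open>h_r e j / h_l e j\<close>, hence is at most
  \<open>M * mu e m\<close>. This controls all indicator sums inside \<open>D\<close>.\<close>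

lemma lincomb_block_bound:
  assumes "finite D" "card D \<le> m" "0 \<le> t" "\<And>i. i \<in> D \<Longrightarrow> \<bar>b i\<bar> \<le> t" "0 \<le> M" "1 \<le> m"
    and t: "\<And>j. 1 \<le> j \<Longrightarrow> j \<le> m \<Longrightarrow> t * h_l e j \<le> M"
  shows "norm (lincomb b D) \<le> 2 * (M * mu e m)"
proof (cases "t = 0")
  case True
  then have "lincomb b D = 0" using assms(4) by (simp add: lincomb_def)
  then show ?thesis using assms mu_ge_1[of m] by simp
next
  case False
  then have t0: "t > 0" using assms by simp
  have nn: "0 \<le> M * mu e m" using assms mu_ge_1[of m] by simp
  \<comment> \<open>The bound for indicator sums carries a division by \<open>t\<close>, hence the
    separate case \<open>t = 0\<close>.\<close>
  have "norm (lincomb b D) \<le> 2 * (t * (M * mu e m / t))"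
  proof (rule lincomb_bounded_coefficients)
    fix A assume A: "A \<subseteq> D"
    then have fA: "finite A" using assms finite_subset by blast
    show "norm (\<Sum>k\<in>A. e k) \<le> M * mu e m / t"
    proof (cases "A = {}")
      case True then show ?thesis using nn t0 by simp
    next
      case ne: False
      define j where "j = card A"
      have j: "1 \<le> j" "j \<le> m" using ne fA A assms card_mono[of D A] by (auto simp: j_def Suc_le_eq card_gt_0_iff)
      have "t * norm (\<Sum>k\<in>A. e k) \<le> t * h_r e j" using h_r_ge[OF fA] t0 by (simp add: j_def)
      also have "\<dots> = (t * h_l e j) * (h_r e j / h_l e j)" using h_l_pos[OF j(1)] by simp
      also have "\<dots> \<le> M * mu e m"
        using h_l_pos[OF j(1)] h_l_le_h_r[of j] assms j
        by (intro mult_mono t ratio_le_mu) auto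
      finally show ?thesis using t0 by (simp add: field_simps)
    qed
  qed (use assms t0 nn in auto)
  then show ?thesis using t0 by simp
qed

text \<open>Induction by halving: \<open>A\<close> takes the \<open>m\<close> largest coefficients,
  and the rest is cut into two blocks of size at most \<open>m\<close>, with coefficients at most
  the minimum \<open>t\<close> over \<open>A\<close>. The blocks cost
  \<open>2 * (M * mu e m)\<close> each, together \<open>8 * (M * (mu e m / 2))\<close>, which is
  what \<open>mu_sum_doubling\<close> supplies; hence the constant 8.\<close>

lemma lincomb_le_mu_sum:
  assumes "finite G" "0 \<le> M"
    and "\<And>A t. \<lbrakk>A \<subseteq> G; A \<noteq> {}; t > 0; \<And>i. i \<in> A \<Longrightarrow> t \<le> \<bar>b i\<bar>\<rbrakk> \<Longrightarrow> t * h_l e (card A) \<le> M"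
  shows "norm (lincomb b G) \<le> 8 * (M * mu_sum (card G))"
  using assms
proof (induction "card G" arbitrary: G rule: less_induct)
  case less
  have msum0: "0 \<le> M * mu_sum n" for n
    using mu_sum_mono[of 0 n] \<open>0 \<le> M\<close> by (simp add: mu_sum_def)
  \<comment> \<open>Sizes \<open>j\<close> below \<open>card A\<close> are reached by passing to a
    subset of \<open>A\<close>, and \<open>t = 0\<close> is added as a trivial case.\<close>
  have hyp: "t * h_l e j \<le> M"
    if "A \<subseteq> G" "0 \<le> t" "\<And>i. i \<in> A \<Longrightarrow> t \<le> \<bar>b i\<bar>" "1 \<le> j" and j: "j \<le> card A" for A t j
  proof (cases "t = 0")
    case False
    obtain A' where A': "A' \<subseteq> A" "card A' = j"
      using obtain_subset_with_card_n[OF j] by metis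
    have "t * h_l e (card A') \<le> M"
      by (rule less.prems(3)) (use A' that False in auto)
    then show ?thesis using A' by simp
  qed (use less.prems in simp)
  consider "card G = 0" | "card G = 1" | "card G \<ge> 2" by linarith
  then show ?case
  proof cases
    case 1 then show ?thesis using less.prems by (simp add: mu_sum_def)
  next
    \<comment> \<open>Half of 1 rounds down to 0, so a singleton cannot be halved and forms its own
      base case.\<close>
    case 2
    then obtain g where g: "G = {g}" by (auto simp: card_1_singleton_iff)
    have "\<bar>b g\<bar> * h_l e j \<le> M" if "1 \<le> j" "j \<le> 1" for j
      by (rule hyp[of "{g}"]) (use g that in auto)
    then have "norm (lincomb b G) \<le> 2 * (M * mu e 1)"
      by (intro lincomb_block_bound[of G 1 "\<bar>b g\<bar>"]) (use g less.prems in auto)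
    moreover have "mu_sum (card G) = mu e 1" using 2 by (simp add: mu_sum_def)
    ultimately show ?thesis using msum0[of "card G"] by simp
  next
    case 3
    define m where "m = card G div 2"
    have m: "1 \<le> m" "m < card G" "2 * m \<le> card G" "card G - m \<le> 2 * m" using 3 by (auto simp: m_def)
    obtain A where A: "A \<subseteq> G" "card A = m" "\<forall>i\<in>A. \<forall>j\<in>G - A. \<bar>b j\<bar> \<le> \<bar>b i\<bar>"
      using exists_greedy_subset[OF less.prems(1), of m b] m by auto
    have fA: "finite A" using A less.prems finite_subset by blast
    have Ane: "A \<noteq> {}" using A m by auto
    define t where "t = Min ((\<lambda>i. \<bar>b i\<bar>) ` A)"
    have tle: "\<And>i. i \<in> A \<Longrightarrow> t \<le> \<bar>b i\<bar>" using fA by (simp add: t_def)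
    have "t \<in> (\<lambda>i. \<bar>b i\<bar>) ` A" unfolding t_def using fA Ane by (intro Min_in) auto
    then obtain i0 where i0: "i0 \<in> A" "t = \<bar>b i0\<bar>" by auto
    have t0: "0 \<le> t" using i0 by simp
    have tge: "\<bar>b j\<bar> \<le> t" if "j \<in> G - A" for j using A i0 that by simp
    have cD: "card (G - A) = card G - m" using A fA by (simp add: card_Diff_subset)
    have mD: "m \<le> card (G - A)" using cD m by simp
    obtain D where D: "D \<subseteq> G - A" "card D = m" using obtain_subset_with_card_n[OF mD] by metis
    have fD: "finite (G - A)" "finite D" using less.prems(1) D finite_subset[of D "G - A"] by auto
    have th: "t * h_l e j \<le> M" if "1 \<le> j" "j \<le> m" for j
      by (rule hyp[of A]) (use A t0 tle that in auto)
    have D1: "norm (lincomb b D) \<le> 2 * (M * mu e m)"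
      by (rule lincomb_block_bound[OF _ _ t0 _ _ m(1) th]) (use D fD tge less.prems in auto)
    have D2: "norm (lincomb b (G - A - D)) \<le> 2 * (M * mu e m)"
      by (rule lincomb_block_bound[OF _ _ t0 _ _ m(1) th])
         (use D fD tge less.prems cD m in \<open>auto simp: card_Diff_subset\<close>)
    have IH: "norm (lincomb b A) \<le> 8 * (M * mu_sum (card A))"
      by (rule less.hyps) (use A m fA less.prems in auto)
    have "lincomb b G = lincomb b A + (lincomb b D + lincomb b (G - A - D))"
      using less.prems fD D A by (simp add: lincomb_Diff)
    then have "norm (lincomb b G) \<le> norm (lincomb b A) + (norm (lincomb b D) + norm (lincomb b (G - A - D)))"
      using norm_triangle_ineq[of "lincomb b A" "lincomb b D + lincomb b (G - A - D)"]
        norm_triangle_ineq[of "lincomb b D" "lincomb b (G - A - D)"] by simp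
    also have "\<dots> \<le> 8 * (M * (mu_sum m + mu e m / 2))"
      using IH D1 D2 A by (simp add: algebra_simps)
    also have "\<dots> \<le> 8 * (M * mu_sum (card G))"
      using mu_sum_doubling[OF m(1,3)] less.prems by (intro mult_left_mono) auto
    finally show ?thesis .
  qed
qed

section \<open>Uniformly bounded greedy projections and lower bounds\<close>

text \<open>Stated for finite expansions and arbitrary greedy sets, ties included, so that no
  ordering of all the naturals enters.\<close>

definition greedy_bounded :: "real \<Rightarrow> bool" where
  "greedy_bounded K \<longleftrightarrow> K \<ge> 1 \<and> (\<forall>c F A. finite F \<longrightarrow> A \<subseteq> F \<longrightarrow>
     (\<forall>i\<in>A. \<forall>j\<in>F - A. \<bar>c j\<bar> \<le> \<bar>c i\<bar>) \<longrightarrow> norm (lincomb c A) \<le> K * norm (lincomb c F))"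

lemma greedy_boundedD:
  "\<lbrakk>greedy_bounded K; finite F; A \<subseteq> F; \<And>i j. i \<in> A \<Longrightarrow> j \<in> F \<Longrightarrow> j \<notin> A \<Longrightarrow> \<bar>c j\<bar> \<le> \<bar>c i\<bar>\<rbrakk>
   \<Longrightarrow> norm (lincomb c A) \<le> K * norm (lincomb c F)"
  unfolding greedy_bounded_def by blast

text \<open>Restricting to the greedy set \<open>G\<close> costs \<open>K\<close>; truncating the
  coefficients there to modulus \<open>t\<close> costs \<open>1 + K\<close>. The truncated
  \<open>d\<close> has constant modulus on \<open>G\<close>, so all subsets are greedy for it:
  passing to \<open>A\<close> costs \<open>K\<close>, and its two sign parts cost \<open>K\<close>
  each.\<close>

lemma indicator_bound_finite:
  assumes K: "greedy_bounded K" and "finite F" "A \<subseteq> F" "t > 0" "\<And>i. i \<in> A \<Longrightarrow> t \<le> \<bar>c i\<bar>"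
  shows "t * norm (\<Sum>k\<in>A. e k) \<le> 2 * K ^ 3 * (1 + K) * norm (lincomb c F)"
proof -
  have K1: "K \<ge> 1" using K by (simp add: greedy_bounded_def)
  define G where "G = {i\<in>F. t \<le> \<bar>c i\<bar>}"
  have fG: "finite G" and AG: "A \<subseteq> G" using assms by (auto simp: G_def)
  have nG: "norm (lincomb c G) \<le> K * norm (lincomb c F)"
    by (rule greedy_boundedD[OF K]) (use assms in \<open>auto simp: G_def\<close>)
  define m where "m i = t / \<bar>c i\<bar>" for i
  define d where "d i = m i * c i" for i
  have dG: "d i = t * sgn (c i)" "c i \<noteq> 0" if "i \<in> G" for i
    using that assms(4) by (auto simp: d_def m_def G_def sgn_if)
  have "norm (lincomb (\<lambda>i. m i * c i) G) \<le> 1 * ((1 + K) * norm (lincomb c G))"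
  proof (rule layer_cake)
    fix s :: real assume s: "s > 0"
    \<comment> \<open>Small multipliers belong to large coefficients, so the complement
      \<open>U\<close> of a level set is greedy for \<open>c\<close>; the level set itself then
      costs \<open>1 + K\<close>.\<close>
    define U where "U = {i\<in>G. \<not> m i \<ge> s}"
    have "norm (lincomb c U) \<le> K * norm (lincomb c G)"
    proof (rule greedy_boundedD[OF K fG])
      fix i j assume "i \<in> U" "j \<in> G" "j \<notin> U"
      then have "t / \<bar>c i\<bar> \<le> t / \<bar>c j\<bar>" "0 < \<bar>c i\<bar>" "0 < \<bar>c j\<bar>"
        using dG(2) by (auto simp: U_def m_def)
      then show "\<bar>c j\<bar> \<le> \<bar>c i\<bar>" using assms(4) by (simp add: field_simps)
    qed (auto simp: U_def)
    moreover have "{i\<in>G. m i \<ge> s} = G - U" by (auto simp: U_def)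
    ultimately show "norm (lincomb c {i\<in>G. m i \<ge> s}) \<le> (1 + K) * norm (lincomb c G)"
      using norm_triangle_ineq4[of "lincomb c G" "lincomb c U"]
      by (simp add: lincomb_Diff fG U_def algebra_simps)
  qed (use fG K1 assms(4) in \<open>auto simp: m_def G_def\<close>)
  then have ndG: "norm (lincomb d G) \<le> (1 + K) * norm (lincomb c G)" by (simp add: d_def[abs_def])
  have sub: "norm (lincomb d B) \<le> K * norm (lincomb d B')" if "B \<subseteq> B'" "B' \<subseteq> G" for B B'
    by (rule greedy_boundedD[OF K])
       (use that fG dG finite_subset assms(4) in \<open>auto simp: abs_mult abs_sgn_eq subset_iff\<close>)
  define Ap where "Ap = {i\<in>A. c i > 0}"
  have fA: "finite A" using AG fG finite_subset by blast
  have "t *\<^sub>R (\<Sum>k\<in>A. e k) = t *\<^sub>R (\<Sum>k\<in>Ap. e k) + t *\<^sub>R (\<Sum>k\<in>A - Ap. e k)"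
    unfolding scaleR_add_right[symmetric]
    by (subst sum.union_disjoint[symmetric]) (use fA in \<open>auto simp: Ap_def intro!: arg_cong[of _ _ "sum e"]\<close>)
  also have "t *\<^sub>R (\<Sum>k\<in>Ap. e k) = lincomb d Ap"
    unfolding lincomb_def scaleR_sum_right using AG dG by (intro sum.cong) (auto simp: Ap_def subset_iff)
  also have "t *\<^sub>R (\<Sum>k\<in>A - Ap. e k) = - lincomb d (A - Ap)"
    unfolding lincomb_def scaleR_sum_right sum_negf[symmetric]
  proof (intro sum.cong refl)
    fix i assume i: "i \<in> A - Ap"
    then have "i \<in> G" using AG by auto
    then have "c i < 0" using i dG(2)[of i] by (auto simp: Ap_def)
    then show "t *\<^sub>R e i = - (d i *\<^sub>R e i)" using dG[OF \<open>i \<in> G\<close>] by simp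
  qed
  also have "norm (lincomb d Ap + - lincomb d (A - Ap)) \<le> K * norm (lincomb d A) + K * norm (lincomb d A)"
    using norm_triangle_ineq4[of "lincomb d Ap" "lincomb d (A - Ap)"] sub[of Ap A] sub[of "A - Ap" A] AG
    by (simp add: Ap_def)
  also have "\<dots> = 2 * K * norm (lincomb d A)" by simp
  also have "\<dots> \<le> 2 * K * (K * ((1 + K) * (K * norm (lincomb c F))))"
  proof (rule mult_left_mono)
    have "norm (lincomb d A) \<le> K * norm (lincomb d G)" using sub AG by blast
    also have "\<dots> \<le> K * ((1 + K) * norm (lincomb c G))" using ndG K1 by (intro mult_left_mono) auto
    also have "\<dots> \<le> K * ((1 + K) * (K * norm (lincomb c F)))" using nG K1 by (intro mult_left_mono) auto
    finally show "norm (lincomb d A) \<le> K * ((1 + K) * (K * norm (lincomb c F)))" .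
  qed (use K1 in simp)
  finally show ?thesis using assms(4) by (simp add: power3_eq_cube algebra_simps)
qed

text \<open>From some index on the partial sums of \<open>z\<close> contain \<open>A\<close>, and
  the finite estimate passes to the limit.\<close>

lemma indicator_bound:
  assumes K: "greedy_bounded K" and "finite A" "t > 0" "\<And>i. i \<in> A \<Longrightarrow> t \<le> \<bar>cf z i\<bar>"
  shows "t * norm (\<Sum>k\<in>A. e k) \<le> 2 * K ^ 3 * (1 + K) * norm z"
proof (rule LIMSEQ_le_const)
  show "(\<lambda>n. 2 * K ^ 3 * (1 + K) * norm (lincomb (cf z) {..<n})) \<longlonglongrightarrow> 2 * K ^ 3 * (1 + K) * norm z"
    by (intro tendsto_mult tendsto_const tendsto_norm partial_tendsto)
  obtain n0 where n0: "A \<subseteq> {..<n0}" using finite_nat_bounded[OF assms(2)] by blast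
  show "\<exists>N. \<forall>n\<ge>N. t * norm (\<Sum>k\<in>A. e k) \<le> 2 * K ^ 3 * (1 + K) * norm (lincomb (cf z) {..<n})"
    by (intro exI[of _ n0] allI impI indicator_bound_finite[OF K]) (use n0 assms in auto)
qed

section \<open>The Lebesgue-type inequality\<close>

lemma greedy_ordering_prefix:
  assumes "greedy_ordering e x \<pi>" "i \<in> \<pi> ` {..<N}" "j \<notin> \<pi> ` {..<N}"
  shows "\<bar>cf x j\<bar> \<le> \<bar>cf x i\<bar>"
proof -
  have bij: "bij \<pi>" and dec: "decseq (\<lambda>k. \<bar>cf x (\<pi> k)\<bar>)"
    using assms(1) by (auto simp: greedy_ordering_def decseq_Suc_iff)
  obtain k where k: "i = \<pi> k" "k < N" using assms by auto
  obtain l where l: "j = \<pi> l" using bij by (metis bij_pointE)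
  then have "\<not> l < N" using assms by auto
  then show ?thesis using decseqD[OF dec, of k l] k l by simp
qed

lemma greedy_approx_eq:
  assumes "greedy_ordering e x \<pi>"
  shows "greedy_approx e \<pi> N x = lincomb (cf x) (\<pi> ` {..<N})" "card (\<pi> ` {..<N}) = N"
proof -
  have "inj_on \<pi> {..<N}" using assms by (meson bij_is_inj greedy_ordering_def inj_on_subset subset_UNIV)
  then show "greedy_approx e \<pi> N x = lincomb (cf x) (\<pi> ` {..<N})" "card (\<pi> ` {..<N}) = N"
    by (simp_all add: greedy_approx_def lincomb_def sum.reindex card_image)
qed

lemma greedy_bounded_imp_greedy_approx_bound:
  assumes K: "greedy_bounded K" and g: "greedy_ordering e x \<pi>"
  shows "norm (greedy_approx e \<pi> N x) \<le> K * norm x"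
proof -
  let ?A = "\<pi> ` {..<N}"
  obtain n0 where n0: "?A \<subseteq> {..<n0}" using finite_nat_bounded[of ?A] by blast
  have "norm (lincomb (cf x) ?A) \<le> K * norm x"
  proof (rule LIMSEQ_le_const)
    show "(\<lambda>n. K * norm (lincomb (cf x) {..<n})) \<longlonglongrightarrow> K * norm x"
      by (intro tendsto_mult tendsto_const tendsto_norm partial_tendsto)
    show "\<exists>N'. \<forall>n\<ge>N'. norm (lincomb (cf x) ?A) \<le> K * norm (lincomb (cf x) {..<n})"
      by (intro exI[of _ n0] allI impI greedy_boundedD[OF K] greedy_ordering_prefix[OF g, of _ N]) (use n0 in auto)
  qed
  then show ?thesis using greedy_approx_eq[OF g] by simp
qed

text \<open>Each of the three projections costs \<open>8 * (M * mu_sum N)\<close>, giving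
  \<open>48 * K ^ 3 * (1 + K)\<close> in total once \<open>M\<close> is expanded; the summand 1
  comes from \<open>norm z\<close> itself, as \<open>mu_sum N \<ge> 1\<close>.\<close>

lemma lebesgue_inequality_pointwise:
  assumes K: "greedy_bounded K" and g: "greedy_ordering e x \<pi>" and "N \<ge> 1"
    and y: "finite {k. cf y k \<noteq> 0}" "card {k. cf y k \<noteq> 0} \<le> N"
  shows "norm (x - greedy_approx e \<pi> N x) \<le> (1 + 48 * K ^ 3 * (1 + K)) * (mu_sum N * norm (x - y))"
proof -
  have K1: "K \<ge> 1" using K by (simp add: greedy_bounded_def)
  define A where "A = \<pi> ` {..<N}"
  define B where "B = {k. cf y k \<noteq> 0}"
  define z where "z = x - y"
  define M where "M = 2 * K ^ 3 * (1 + K) * norm z"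
  have fA: "finite A" "card A = N" and fB: "finite B" "card B \<le> N"
    using greedy_approx_eq[OF g, of N] y by (auto simp: A_def B_def)
  have M0: "0 \<le> M" using K1 by (simp add: M_def)
  have hz: "t * h_l e (card D) \<le> M" if "finite D" "t > 0" "\<And>i. i \<in> D \<Longrightarrow> t \<le> \<bar>cf z i\<bar>" for D t
  proof -
    have "t * h_l e (card D) \<le> t * norm (\<Sum>k\<in>D. e k)" using h_l_le[OF that(1)] that(2) by simp
    also have "\<dots> \<le> M" unfolding M_def by (rule indicator_bound[OF K that])
    finally show ?thesis .
  qed
  have cBA: "card (B - A) \<le> N" using fB card_mono[of B "B - A"] by auto
  have mono: "8 * (M * mu_sum k) \<le> 8 * (M * mu_sum N)" if "k \<le> N" for k
    using mu_sum_mono[OF that] M0 by (simp add: mult_left_mono)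
  have 1: "norm (lincomb (cf z) A) \<le> 8 * (M * mu_sum N)"
    using lincomb_le_mu_sum[of A M "cf z"] hz fA M0 finite_subset by metis
  have "norm (lincomb (cf z) (B - A)) \<le> 8 * (M * mu_sum (card (B - A)))"
  proof (rule lincomb_le_mu_sum)
    fix D t assume D: "D \<subseteq> B - A" "t > 0" "\<And>i. i \<in> D \<Longrightarrow> t \<le> \<bar>cf z i\<bar>"
    have "finite D" using D(1) fB(1) finite_subset[of D "B - A"] by blast
    from hz[OF this D(2,3)] show "t * h_l e (card D) \<le> M" .
  qed (use fB M0 in auto)
  then have 2: "norm (lincomb (cf z) (B - A)) \<le> 8 * (M * mu_sum N)" using mono[OF cBA] by simp
  have "norm (lincomb (cf x) (B - A)) \<le> 8 * (M * mu_sum (card (B - A)))"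
  proof (rule lincomb_le_mu_sum)
    fix D t assume D: "D \<subseteq> B - A" "D \<noteq> {}" "t > 0" "\<And>i. i \<in> D \<Longrightarrow> t \<le> \<bar>cf x i\<bar>"
    \<comment> \<open>Since \<open>card B \<le> card A\<close>, a set \<open>D'\<close> of the size
      of \<open>D\<close> fits inside \<open>A - B\<close>. There \<open>y\<close> vanishes, so
      \<open>cf z\<close> agrees with \<open>cf x\<close>, which is at least \<open>t\<close> in
      modulus by greediness; \<open>h_l\<close> sees only the cardinality.\<close>
    have "card (A \<inter> B) + card (A - B) = card A" "card (A \<inter> B) + card (B - A) = card B"
      using fA fB by (metis card_Int_Diff add.commute Int_commute)+
    then have "card (B - A) \<le> card (A - B)" using fA fB by linarith
    moreover have "card D \<le> card (B - A)" using D fB by (intro card_mono) auto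
    ultimately obtain D' where D': "D' \<subseteq> A - B" "card D' = card D"
      by (meson le_trans obtain_subset_with_card_n)
    obtain d where d: "d \<in> D" using D by auto
    have "t * h_l e (card D') \<le> M"
    proof (rule hz)
      fix i assume i: "i \<in> D'"
      then have "cf z i = cf x i" using D' by (auto simp: z_def cf_diff B_def)
      moreover have "\<bar>cf x d\<bar> \<le> \<bar>cf x i\<bar>"
        by (rule greedy_ordering_prefix[OF g, of _ N]) (use i D' d D in \<open>auto simp: A_def\<close>)
      ultimately show "t \<le> \<bar>cf z i\<bar>" using D(4)[OF d] by simp
    qed (use D' D fA finite_subset[of D' "A - B"] in auto)
    then show "t * h_l e (card D) \<le> M" using D' by simp
  qed (use fB M0 in auto)
  then have 3: "norm (lincomb (cf x) (B - A)) \<le> 8 * (M * mu_sum N)" using mono[OF cBA] by simp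
  \<comment> \<open>On \<open>A \<union> B\<close> the projection reproduces \<open>y\<close>, so
    the difference of the projections of \<open>x\<close> and \<open>y\<close> yields the
    decomposition.\<close>
  have "lincomb (cf y) (A \<union> B) = y"
  proof -
    have "(\<lambda>k. cf y k *\<^sub>R e k) sums (\<Sum>k\<in>A\<union>B. cf y k *\<^sub>R e k)"
      by (rule sums_finite) (use fA fB in \<open>auto simp: B_def\<close>)
    then show ?thesis using sums_unique2[OF _ cf_sums[of y]] by (simp add: lincomb_def)
  qed
  moreover have "lincomb (cf x) (A \<union> B) - lincomb (cf y) (A \<union> B) = lincomb (cf z) (A \<union> B)"
    by (simp add: z_def partial_diff)
  moreover have "lincomb c (A \<union> B) = lincomb c A + lincomb c (B - A)" for c
    using lincomb_Un_disjoint[of A "B - A" c] fA fB by (simp add: Un_Diff_cancel)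
  ultimately have "x - lincomb (cf x) A = z - lincomb (cf z) A - lincomb (cf z) (B - A) + lincomb (cf x) (B - A)"
    unfolding z_def by (simp add: algebra_simps)
  then have "norm (x - lincomb (cf x) A)
      \<le> norm z + norm (lincomb (cf z) A) + norm (lincomb (cf z) (B - A)) + norm (lincomb (cf x) (B - A))"
    by (smt (verit) norm_triangle_ineq norm_triangle_ineq4)
  also have "\<dots> \<le> norm z + 24 * (M * mu_sum N)" using 1 2 3 by simp
  also have "\<dots> \<le> mu_sum N * norm z + 24 * (M * mu_sum N)"
    using mu_sum_ge_1[OF \<open>N \<ge> 1\<close>] mult_right_mono[of 1 "mu_sum N" "norm z"] by simp
  also have "\<dots> = (1 + 48 * K ^ 3 * (1 + K)) * (mu_sum N * norm z)"
    by (simp add: M_def algebra_simps)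
  finally show ?thesis using greedy_approx_eq[OF g] by (simp add: A_def z_def)
qed

text \<open>\<open>1 + K\<close> is an admissible constant, so the infimum is over a nonempty set.
  Every admissible constant is at least 1, because at \<open>N = 0\<close> the remainder is the
  whole vector; \<open>e 0\<close> serves as a nonzero vector with greedy ordering
  \<open>id\<close>.\<close>

lemma qg_constant_ge_1:
  assumes K: "greedy_bounded K" shows "1 \<le> qg_constant e"
  unfolding qg_constant_def
proof (rule cInf_greatest)
  have K1: "K \<ge> 1" using K by (simp add: greedy_bounded_def)
  have "norm (greedy_approx e \<pi> N x) \<le> (1 + K) * norm x \<and>
      norm (x - greedy_approx e \<pi> N x) \<le> (1 + K) * norm x" if "greedy_ordering e x \<pi>" for x \<pi> N
    using greedy_bounded_imp_greedy_approx_bound[OF K that, of N]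
      norm_triangle_ineq4[of x "greedy_approx e \<pi> N x"] norm_ge_zero[of x]
    unfolding distrib_right mult_1_left by linarith
  then show "{K. \<forall>x \<pi> N. greedy_ordering e x \<pi> \<longrightarrow> norm (greedy_approx e \<pi> N x) \<le> K * norm x \<and>
      norm (x - greedy_approx e \<pi> N x) \<le> K * norm x} \<noteq> {}" by blast
next
  fix L assume "L \<in> {K. \<forall>x \<pi> N. greedy_ordering e x \<pi> \<longrightarrow> norm (greedy_approx e \<pi> N x) \<le> K * norm x \<and>
      norm (x - greedy_approx e \<pi> N x) \<le> K * norm x}"
  then have L: "\<And>x \<pi> N. greedy_ordering e x \<pi> \<Longrightarrow> norm (x - greedy_approx e \<pi> N x) \<le> L * norm x" by blast
  obtain a b where ab: "0 < a" "\<And>k. a \<le> norm (e k)" using norm_e_bounds by blast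
  have "cf (e 0) k = (if k = 0 then 1 else 0)" for k
    using cf_lincomb[of "{0}" k "\<lambda>_. 1"] by (simp add: lincomb_def)
  then have "greedy_ordering e (e 0) id" by (simp add: greedy_ordering_def)
  from L[OF this, of 0] have "norm (e 0) \<le> L * norm (e 0)" by (simp add: greedy_approx_def)
  moreover have "norm (e 0) > 0" using ab less_le_trans by blast
  ultimately show "1 \<le> L" by simp
qed

lemma lebesgue_inequality:
  assumes K: "greedy_bounded K"
  shows "\<exists>C>0. \<forall>N\<ge>1. \<forall>x \<pi>. greedy_ordering e x \<pi> \<longrightarrow>
           norm (x - greedy_approx e \<pi> N x)
             \<le> C * 8 * qg_constant e ^ 5 * (\<Sum>k=1..N. mu e k * (1 / real k)) * sigma e N x"
proof -
  define C where "C = 1 + 48 * K ^ 3 * (1 + K)"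
  have K1: "K \<ge> 1" using K by (simp add: greedy_bounded_def)
  have C: "C > 0" using K1 unfolding C_def by (intro add_pos_nonneg) auto
  define Q where "Q = qg_constant e"
  have Q: "Q \<ge> 1" using qg_constant_ge_1[OF K] by (simp add: Q_def)
  have "norm (x - greedy_approx e \<pi> N x) \<le> C * mu_sum N * sigma e N x"
    if "N \<ge> 1" "greedy_ordering e x \<pi>" for N x \<pi>
  proof -
    have p: "C * mu_sum N > 0" using C mu_sum_ge_1[OF that(1)] by simp
    \<comment> \<open>Division by the positive factor turns the pointwise estimate into a lower
      bound for the infimum over \<open>y\<close>.\<close>
    have "norm (x - greedy_approx e \<pi> N x) / (C * mu_sum N) \<le> sigma e N x"
      unfolding sigma_def
    proof (rule cInf_greatest)
      have "cf 0 k = 0" for k using cf_scale[of k 0 0] by simp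
      then show "{norm (x - y) |y. finite {k. cf y k \<noteq> 0} \<and> card {k. cf y k \<noteq> 0} \<le> N} \<noteq> {}"
        by (auto intro!: exI[of _ "0::'a"])
    next
      fix r assume "r \<in> {norm (x - y) |y. finite {k. cf y k \<noteq> 0} \<and> card {k. cf y k \<noteq> 0} \<le> N}"
      then obtain y where "r = norm (x - y)" "finite {k. cf y k \<noteq> 0}" "card {k. cf y k \<noteq> 0} \<le> N" by blast
      then have "norm (x - greedy_approx e \<pi> N x) \<le> C * (mu_sum N * r)"
        using lebesgue_inequality_pointwise[OF K that(2,1)] by (simp add: C_def)
      then show "norm (x - greedy_approx e \<pi> N x) / (C * mu_sum N) \<le> r"
        using p by (simp add: field_simps)
    qed
    then show ?thesis using p by (simp add: field_simps)
  qed
  then show ?thesis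
    \<comment> \<open>The witness is chosen so that the prescribed factor \<open>8 * Q ^ 5\<close>
      cancels.\<close>
    using C Q by (intro exI[of _ "C / (8 * Q ^ 5)"]) (auto simp: mu_sum_def Q_def[symmetric])
qed

section \<open>The gliding hump\<close>

text \<open>
  A greedy ordering is a bijection of the naturals, so an infinitely supported vector with a
  vanishing coefficient has none, and quasi-greediness says nothing about it. Hence the blocks of
  the gliding hump have no zero coefficients on their interval; zeros are replaced by a small
  \<open>\<tau>\<close>, which leaves the large greedy sum untouched.
\<close>

definition greedy_block :: "real \<Rightarrow> nat \<Rightarrow> nat \<Rightarrow> (nat \<Rightarrow> real) \<Rightarrow> (nat \<Rightarrow> nat) \<Rightarrow> nat \<Rightarrow> bool" where
  "greedy_block \<eta> M M' c p j \<longleftrightarrow> M < M' \<and> M + j \<le> M' \<and>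
     bij_betw p {M..<M'} {M..<M'} \<and>
     (\<forall>k. M \<le> k \<longrightarrow> Suc k < M' \<longrightarrow> \<bar>c (p (Suc k))\<bar> \<le> \<bar>c (p k)\<bar>) \<and>
     (\<forall>k\<in>{M..<M'}. c k \<noteq> 0 \<and> \<bar>c k\<bar> \<le> \<eta>) \<and>
     (\<forall>n\<le>M'. norm (lincomb c {M..<n}) \<le> \<eta>) \<and>
     1 \<le> norm (lincomb c (p ` {M..<M + j}))"

text \<open>A violation of \<open>greedy_bounded K\<close> for large \<open>K\<close> is scaled to a
  vector \<open>w\<close> of norm \<open>\<delta>\<close> with a huge greedy sum. Dropping the
  indices below \<open>M\<close> loses a bounded amount, so norm at least 1 remains.\<close>

lemma exists_greedy_block:
  assumes unb: "\<And>K. \<not> greedy_bounded K" and \<eta>: "\<eta> > 0"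
  shows "\<exists>M' c p j. greedy_block \<eta> M M' c p j"
proof -
  obtain b where ab: "0 < b" "\<And>k. norm (e k) \<le> b" using norm_e_bounds by metis
  obtain \<beta> where \<beta>: "\<beta> \<ge> 1" "\<And>x n. norm (lincomb (cf x) {..<n}) \<le> \<beta> * norm x"
    using partial_sums_uniformly_bounded by blast
  obtain B where B: "B > 0" "\<And>x k. \<bar>cf x k\<bar> \<le> B * norm x" using coefficients_bounded by blast
  \<comment> \<open>The first entry keeps differences of two partial sums of \<open>w\<close> below
    \<open>\<eta> / 2\<close>, leaving \<open>\<eta> / 2\<close> for the perturbation by
    \<open>\<tau>\<close>; the second keeps the coefficients below \<open>\<eta>\<close>.\<close>
  define \<delta> where "\<delta> = min (\<eta> / (4 * \<beta>)) (\<eta> / B)"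
  have \<delta>: "\<delta> > 0" "2 * (\<beta> * \<delta>) \<le> \<eta> / 2" "B * \<delta> \<le> \<eta>"
    using \<eta> \<beta>(1) B(1) by (auto simp: \<delta>_def min_def field_simps)
  \<comment> \<open>Chosen so that \<open>K * \<delta>\<close> exceeds 1 plus the largest possible
    contribution of the \<open>M\<close> indices below \<open>M\<close>.\<close>
  define K where "K = 1 + (1 + real M * (B * \<delta> * b)) / \<delta>"
  have K1: "K \<ge> 1" using \<delta> B ab by (simp add: K_def)
  have K\<delta>: "K * \<delta> = \<delta> + 1 + real M * (B * \<delta> * b)" using \<delta> by (simp add: K_def field_simps)
  from unb[of K] K1 obtain c0 F A0 where 0: "finite F" "A0 \<subseteq> F"
      "\<forall>i\<in>A0. \<forall>j\<in>F - A0. \<bar>c0 j\<bar> \<le> \<bar>c0 i\<bar>" "norm (lincomb c0 A0) > K * norm (lincomb c0 F)"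
    unfolding greedy_bounded_def by (auto simp: not_le)
  define v where "v = norm (lincomb c0 F)"
  \<comment> \<open>If the whole sum vanished, so would all its coefficients, against the strict
    violation; hence scaling is possible.\<close>
  have "v > 0"
  proof (rule ccontr)
    assume "\<not> v > 0"
    then have z: "lincomb c0 F = 0" by (simp add: v_def)
    have "c0 k = 0" if "k \<in> F" for k
      using B(2)[of k "lincomb c0 F"] cf_lincomb[OF 0(1), of k c0] that z by simp
    then have "lincomb c0 A0 = 0" using 0(2) by (auto simp: lincomb_def intro!: sum.neutral)
    then show False using 0(4) z by simp
  qed
  define c1 where "c1 k = (\<delta> / v) * c0 k" for k
  define w where "w = lincomb c1 F"
  have sc: "lincomb c1 S = (\<delta> / v) *\<^sub>R lincomb c0 S" for S
    unfolding c1_def by (rule lincomb_scale)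
  have w: "norm w = \<delta>" using \<open>v > 0\<close> \<delta>(1) unfolding w_def sc norm_scaleR v_def by simp
  have A0: "norm (lincomb c1 A0) > K * \<delta>"
  proof -
    have "(\<delta> / v) * (K * v) < (\<delta> / v) * norm (lincomb c0 A0)"
      using 0(4) \<open>v > 0\<close> \<delta> unfolding v_def[symmetric] by (intro mult_strict_left_mono) auto
    then show ?thesis using \<open>v > 0\<close> \<delta>(1) by (simp add: sc mult.commute)
  qed
  have g1: "\<bar>c1 j\<bar> \<le> \<bar>c1 i\<bar>" if "i \<in> A0" "j \<in> F - A0" for i j
    using 0(3) that \<delta> \<open>v > 0\<close> unfolding c1_def abs_mult by (intro mult_left_mono) auto
  have cw: "cf w k = (if k \<in> F then c1 k else 0)" for k
    unfolding w_def by (rule cf_lincomb[OF 0(1)])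
  have cb: "\<bar>cf w k\<bar> \<le> B * \<delta>" for k using B(2)[of k w] w by simp
  define A where "A = {k\<in>A0. M \<le> k \<and> c1 k \<noteq> 0}"
  have fA0: "finite A0" using 0 finite_subset by blast
  then have fA: "finite A" by (simp add: A_def)
  have cA: "cf w k = c1 k" if "k \<in> A0" for k using cw that 0(2) by auto
  have nA: "norm (lincomb (cf w) A) \<ge> 1"
  proof -
    have "lincomb c1 A0 = lincomb (cf w) A0" using cA by (intro lincomb_cong) auto
    also have "\<dots> = lincomb (cf w) (A0 \<inter> {..<M}) + lincomb (cf w) (A0 - {..<M})"
      using lincomb_Un_disjoint[of "A0 \<inter> {..<M}" "A0 - {..<M}" "cf w"] fA0 by (simp add: Int_Diff_Un Int_Diff_disjoint)
    also have "lincomb (cf w) (A0 - {..<M}) = lincomb (cf w) A"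
      unfolding lincomb_def using fA0 by (intro sum.mono_neutral_right) (auto simp: A_def cA)
    finally have "K * \<delta> < norm (lincomb (cf w) (A0 \<inter> {..<M})) + norm (lincomb (cf w) A)"
      using A0 norm_triangle_ineq[of "lincomb (cf w) (A0 \<inter> {..<M})" "lincomb (cf w) A"] by simp
    moreover have "norm (lincomb (cf w) (A0 \<inter> {..<M})) \<le> (\<Sum>k\<in>A0 \<inter> {..<M}. B * \<delta> * b)"
      unfolding lincomb_def norm_scaleR using cb ab B(1) \<delta>(1)
      by (intro sum_norm_le) (auto intro!: mult_mono)
    moreover have "real (card (A0 \<inter> {..<M})) * (B * \<delta> * b) \<le> real M * (B * \<delta> * b)"
      using card_mono[of "{..<M}" "A0 \<inter> {..<M}"] B \<delta> ab by (intro mult_right_mono) auto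
    ultimately show ?thesis using K\<delta> \<delta>(1) by simp
  qed
  then have Ane: "A \<noteq> {}" by auto
  obtain n0 where n0: "F \<subseteq> {..<n0}" using finite_nat_bounded[OF 0(1)] by blast
  define M' where "M' = max n0 (Suc M)"
  have M': "M < M'" "F \<subseteq> {..<M'}" using n0 by (auto simp: M'_def)
  have AM: "A \<subseteq> {M..<M'}" using M' 0(2) by (auto simp: A_def)
  \<comment> \<open>Three demands: \<open>\<tau>\<close> does not exceed any coefficient on
    \<open>A\<close>, so \<open>A\<close> stays greedy; it is at most \<open>\<eta>\<close>; and
    filling up to \<open>M'\<close> zeros changes norms by at most
    \<open>\<eta> / 2\<close>.\<close>
  define \<tau> where "\<tau> = min (Min ((\<lambda>k. \<bar>c1 k\<bar>) ` A)) (min \<eta> (\<eta> / 2 / (real M' * b)))"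
  have "Min ((\<lambda>k. \<bar>c1 k\<bar>) ` A) > 0" using fA Ane by (simp add: A_def)
  then have \<tau>: "\<tau> > 0" "\<tau> \<le> \<eta>" using \<eta> M' ab by (auto simp: \<tau>_def)
  have \<tau>A: "\<tau> \<le> \<bar>c1 k\<bar>" if "k \<in> A" for k
    using fA that by (auto simp: \<tau>_def min.coboundedI1)
  have \<tau>M: "real M' * (\<tau> * b) \<le> \<eta> / 2"
  proof -
    have "\<tau> \<le> \<eta> / 2 / (real M' * b)" by (simp add: \<tau>_def)
    then have "\<tau> * (real M' * b) \<le> \<eta> / 2" using M' ab by (subst (asm) pos_le_divide_eq) auto
    then show ?thesis by (simp add: mult_ac)
  qed
  define c where "c k = (if cf w k = 0 then \<tau> else cf w k)" for k
  have cA': "c k = c1 k" if "k \<in> A" for k using that cA by (auto simp: c_def A_def)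
  have "\<bar>c j\<bar> \<le> \<bar>c i\<bar>" if i: "i \<in> A" and j: "j \<in> {M..<M'} - A" for i j
  proof (cases "cf w j = 0")
    case True then show ?thesis using \<tau>A[OF i] cA'[OF i] \<tau> by (simp add: c_def)
  next
    case False
    then have "j \<in> F" "c1 j \<noteq> 0" "c j = c1 j" using cw[of j] by (auto simp: c_def split: if_splits)
    moreover from this have "j \<notin> A0" using j by (auto simp: A_def)
    ultimately show ?thesis using g1[of i j] i cA'[OF i] by (auto simp: A_def)
  qed
  from decreasing_arrangement[where c = c, OF AM this] obtain p where
    p: "bij_betw p {M..<M'} {M..<M'}" "p ` {M..<M + card A} = A"
      "\<forall>k. M \<le> k \<longrightarrow> Suc k < M' \<longrightarrow> \<bar>c (p (Suc k))\<bar> \<le> \<bar>c (p k)\<bar>" by blast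
  have part: "norm (lincomb c {M..<n}) \<le> \<eta>" if "n \<le> M'" for n
  proof (cases "M \<le> n")
    case False then show ?thesis using \<eta> by simp
  next
    case True
    have seg: "{M..<n} = {..<n} - {..<M}" by auto
    then have "lincomb (cf w) {M..<n} = lincomb (cf w) {..<n} - lincomb (cf w) {..<M}"
      unfolding seg using True by (intro lincomb_Diff) auto
    then have 1: "norm (lincomb (cf w) {M..<n}) \<le> \<eta> / 2"
      using norm_triangle_ineq4[of "lincomb (cf w) {..<n}" "lincomb (cf w) {..<M}"] \<beta>(2)[of w n] \<beta>(2)[of w M] w \<delta>(2)
      by simp
    have "norm (lincomb (\<lambda>k. c k - cf w k) {M..<n}) \<le> (\<Sum>k\<in>{M..<n}. \<tau> * b)"
      unfolding lincomb_def using \<tau> ab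
      by (intro sum_norm_le) (auto intro!: mult_mono simp: c_def)
    also have "\<dots> \<le> real M' * (\<tau> * b)"
      using that \<tau> ab by (simp add: mult_right_mono)
    finally have "norm (lincomb c {M..<n} - lincomb (cf w) {M..<n}) \<le> \<eta> / 2"
      using \<tau>M by (simp add: lincomb_diff)
    then show ?thesis using 1 norm_triangle_sub[of "lincomb c {M..<n}" "lincomb (cf w) {M..<n}"] by linarith
  qed
  have "card A \<le> M' - M" using card_mono[OF _ AM] by simp
  moreover have "lincomb c A = lincomb (cf w) A" using cA cA' by (intro lincomb_cong) (auto simp: A_def)
  moreover have "c k \<noteq> 0 \<and> \<bar>c k\<bar> \<le> \<eta>" for k
    using cb[of k] \<delta>(3) \<tau> by (auto simp: c_def)
  ultimately have "greedy_block \<eta> M M' c p (card A)"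
    unfolding greedy_block_def using M' p part nA by auto
  then show ?thesis by blast
qed

text \<open>Without a uniform bound, blocks are glued into a vector \<open>x\<close>, every block
  having coefficients no larger than all those of its predecessor, so that the local arrangements
  join to one greedy ordering. The block norms decay geometrically, yet each block contains a greedy
  sum of norm at least 1, so the greedy approximants cannot converge.\<close>

lemma greedy_bounded_if_quasi_greedy:
  assumes qg: "quasi_greedy e"
  shows "\<exists>K. greedy_bounded K"
proof (rule ccontr)
  assume "\<nexists>K. greedy_bounded K"
  then have "\<forall>\<eta> M. \<eta> > 0 \<longrightarrow> (\<exists>M' c p j. greedy_block \<eta> M M' c p j)"
    using exists_greedy_block by blast
  then obtain nx cc pp jj where
    blk: "\<And>\<eta> M. \<eta> > 0 \<Longrightarrow> greedy_block \<eta> M (nx \<eta> M) (cc \<eta> M) (pp \<eta> M) (jj \<eta> M)" by metis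
  \<comment> \<open>The state is the pair of size bound and left endpoint. The next bound is at most
    half the old one, for convergence, and at most the smallest modulus in the block just built, for
    monotonicity.\<close>
  define st where "st = rec_nat (1::real, 0::nat) (\<lambda>_ (\<eta>, M).
     (min (\<eta> / 2) (Min ((\<lambda>k. \<bar>cc \<eta> M k\<bar>) ` {M..<nx \<eta> M})), nx \<eta> M))"
  define \<eta> where "\<eta> i = fst (st i)" for i
  define M where "M i = snd (st i)" for i
  define c where "c i = cc (\<eta> i) (M i)" for i
  define p where "p i = pp (\<eta> i) (M i)" for i
  define J where "J i = jj (\<eta> i) (M i)" for i
  have M0: "M 0 = 0" and e0: "\<eta> 0 = 1" by (simp_all add: M_def \<eta>_def st_def)
  have MS: "M (Suc i) = nx (\<eta> i) (M i)" for i
    by (simp add: M_def \<eta>_def st_def split_beta)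
  have eS: "\<eta> (Suc i) = min (\<eta> i / 2) (Min ((\<lambda>k. \<bar>c i k\<bar>) ` {M i..<M (Suc i)}))" for i
    by (simp add: MS c_def) (simp add: M_def \<eta>_def st_def split_beta)
  have blk': "greedy_block (\<eta> i) (M i) (M (Suc i)) (c i) (p i) (J i)" if "\<eta> i > 0" for i
    using blk[OF that] by (simp add: MS c_def p_def J_def)
  have epos: "\<eta> i > 0" for i
  proof (induction i)
    case (Suc i)
    have "Min ((\<lambda>k. \<bar>c i k\<bar>) ` {M i..<M (Suc i)}) > 0"
      using blk'[OF Suc] by (subst Min_gr_iff) (auto simp: greedy_block_def)
    then show ?case using Suc by (simp add: eS)
  qed (simp add: e0)
  note bl = blk'[OF epos, unfolded greedy_block_def]
  have Mless: "M i < M (Suc i)" and MJ: "M i + J i \<le> M (Suc i)"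
    and pbij: "bij_betw (p i) {M i..<M (Suc i)} {M i..<M (Suc i)}"
    and pdec: "\<And>k. M i \<le> k \<Longrightarrow> Suc k < M (Suc i) \<Longrightarrow> \<bar>c i (p i (Suc k))\<bar> \<le> \<bar>c i (p i k)\<bar>"
    and cbound: "\<And>k. k \<in> {M i..<M (Suc i)} \<Longrightarrow> \<bar>c i k\<bar> \<le> \<eta> i"
    and cpart: "\<And>n. n \<le> M (Suc i) \<Longrightarrow> norm (lincomb (c i) {M i..<n}) \<le> \<eta> i"
    and cbig: "1 \<le> norm (lincomb (c i) (p i ` {M i..<M i + J i}))" for i
    using bl[of i] by auto
  have enext: "\<eta> (Suc i) \<le> \<bar>c i k\<bar>" if "k \<in> {M i..<M (Suc i)}" for i k
    unfolding eS using that by (intro min.coboundedI2 Min_le) auto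
  have ehalf: "\<eta> i \<le> (1/2) ^ i" for i
  proof (induction i)
    case (Suc i)
    have "\<eta> (Suc i) \<le> \<eta> i / 2" by (simp add: eS)
    then show ?case using Suc by simp
  qed (simp add: e0)
  have elim: "\<eta> \<longlonglongrightarrow> 0"
    by (rule Lim_null_comparison[OF _ LIMSEQ_realpow_zero[of "1/2::real"]])
       (use ehalf epos in \<open>auto simp: less_imp_le abs_of_pos\<close>)
  have smono: "strict_mono M" using Mless by (simp add: strict_mono_Suc_iff)
  \<comment> \<open>The number of the block containing \<open>k\<close>.\<close>
  define idx where "idx k = (LEAST n. k < M (Suc n))" for k
  have idx: "M (idx k) \<le> k" "k < M (Suc (idx k))" for k
  proof -
    have "k < M (Suc k)" using strict_mono_imp_increasing[OF smono, of "Suc k"] by simp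
    then show lt: "k < M (Suc (idx k))" unfolding idx_def by (rule LeastI)
    show "M (idx k) \<le> k"
    proof (cases "idx k")
      case (Suc n)
      then have "\<not> k < M (Suc n)" using not_less_Least[of n "\<lambda>n. k < M (Suc n)"] by (simp add: idx_def)
      then show ?thesis using Suc by simp
    qed (simp add: M0)
  qed
  have idx_eq: "idx k = n" if "k \<in> {M n..<M (Suc n)}" for k n
  proof (rule antisym)
    show "idx k \<le> n" unfolding idx_def using that by (intro Least_le) auto
    have "M n < M (Suc (idx k))" using that idx[of k] by auto
    then show "n \<le> idx k" using strict_mono_less[OF smono] by simp
  qed
  have idx_mem: "k \<in> {M (idx k)..<M (Suc (idx k))}" for k using idx by simp
  have idx_lim: "filterlim idx at_top sequentially"
    unfolding filterlim_at_top
  proof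
    fix Z
    have "Z \<le> idx k" if "M Z \<le> k" for k
    proof -
      have "M Z < M (Suc (idx k))" using that idx(2)[of k] by simp
      then show ?thesis using strict_mono_less[OF smono] by simp
    qed
    then show "\<forall>\<^sub>F k in sequentially. Z \<le> idx k" using eventually_sequentially by blast
  qed
  define C where "C k = c (idx k) k" for k
  have Cc: "C k = c i k" if "k \<in> {M i..<M (Suc i)}" for i k using idx_eq[OF that] by (simp add: C_def)
  define W where "W i = lincomb C {M i..<M (Suc i)}" for i
  have W: "norm (W i) \<le> (1/2) ^ i" for i
  proof -
    have "W i = lincomb (c i) {M i..<M (Suc i)}" unfolding W_def using Cc by (rule lincomb_cong)
    then show ?thesis using cpart[of "M (Suc i)" i] ehalf[of i] by simp
  qed
  have "summable W"
    by (rule summable_comparison_test[of _ "\<lambda>i. (1/2::real) ^ i"]) (use W in auto)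
  then obtain x where x: "W sums x" by (auto simp: summable_def)
  have Mpart: "lincomb C {..<M i} = (\<Sum>l<i. W l)" for i
  proof (induction i)
    case (Suc i)
    have "{..<M (Suc i)} = {..<M i} \<union> {M i..<M (Suc i)}" using Mless[of i] by auto
    then show ?case using Suc by (simp add: lincomb_Un_disjoint W_def ivl_disj_int)
  qed (simp add: M0)
  have "(\<lambda>n. lincomb C {..<n}) \<longlonglongrightarrow> x"
  proof -
    \<comment> \<open>A partial sum consists of full blocks and an initial segment of the current
      block; the latter has norm at most \<open>\<eta> (idx n)\<close> and vanishes in the
      limit.\<close>
    have split: "lincomb C {..<n} = (\<Sum>l<idx n. W l) + lincomb (c (idx n)) {M (idx n)..<n}" for n
    proof -
      have "{..<n} = {..<M (idx n)} \<union> {M (idx n)..<n}" using idx[of n] by auto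
      then have "lincomb C {..<n} = lincomb C {..<M (idx n)} + lincomb C {M (idx n)..<n}"
        by (metis finite_atLeastLessThan finite_lessThan ivl_disj_int_one(2) lincomb_Un_disjoint)
      also have "lincomb C {M (idx n)..<n} = lincomb (c (idx n)) {M (idx n)..<n}"
        using idx[of n] by (intro lincomb_cong Cc) auto
      finally show ?thesis by (simp add: Mpart)
    qed
    have "(\<lambda>n. \<Sum>l<idx n. W l) \<longlonglongrightarrow> x"
      using filterlim_compose[OF x[unfolded sums_def] idx_lim] .
    moreover have "(\<lambda>n. lincomb (c (idx n)) {M (idx n)..<n}) \<longlonglongrightarrow> 0"
      by (rule Lim_null_comparison[OF _ filterlim_compose[OF elim idx_lim]])
         (use cpart idx in \<open>auto simp: less_imp_le\<close>)
    ultimately show ?thesis unfolding split using tendsto_add by fastforce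
  qed
  then have "cf x = C" by (intro cf_eqI) (simp add: sums_def lincomb_def)
  then have cfx: "cf x k = C k" for k by (rule fun_cong)
  define \<pi> where "\<pi> k = p (idx k) k" for k
  have \<pi>p: "\<pi> k = p i k" if "k \<in> {M i..<M (Suc i)}" for i k using idx_eq[OF that] by (simp add: \<pi>_def)
  have pmem: "p i k \<in> {M i..<M (Suc i)}" if "k \<in> {M i..<M (Suc i)}" for i k
    using bij_betwE[OF pbij[of i]] that by blast
  have idx\<pi>: "idx (\<pi> k) = idx k" for k
    unfolding \<pi>_def by (rule idx_eq[OF pmem[OF idx_mem]])
  have "inj \<pi>"
  proof (rule injI)
    fix k l assume eq: "\<pi> k = \<pi> l"
    then have i: "idx k = idx l" by (metis idx\<pi>)
    have "p (idx k) k = p (idx k) l" using eq i by (simp add: \<pi>_def)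
    then show "k = l" using bij_betw_imp_inj_on[OF pbij[of "idx k"]] idx_mem[of k] idx_mem[of l] i
      by (simp add: inj_on_def)
  qed
  moreover have "surj \<pi>"
    unfolding surj_def
  proof
    fix l
    obtain k where k: "k \<in> {M (idx l)..<M (Suc (idx l))}" "l = p (idx l) k"
      using bij_betw_imp_surj_on[OF pbij[of "idx l"]] idx_mem[of l] by blast
    then show "\<exists>k. l = \<pi> k" using \<pi>p[OF k(1)] by auto
  qed
  ultimately have bij: "bij \<pi>" by (simp add: bij_def)
  have C\<pi>: "C (\<pi> k) = c i (p i k)" if "k \<in> {M i..<M (Suc i)}" for i k
    using Cc[OF pmem[OF that]] \<pi>p[OF that] by simp
  have "\<bar>C (\<pi> (Suc k))\<bar> \<le> \<bar>C (\<pi> k)\<bar>" for k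
  proof (cases "Suc k < M (Suc (idx k))")
    case True
    then show ?thesis using idx[of k] pdec[of "idx k" k] C\<pi>[of "Suc k" "idx k"] C\<pi>[of k "idx k"] by simp
  next
    case False
    let ?i = "idx k"
    \<comment> \<open>Here \<open>Suc k\<close> opens the next block, whose coefficients are bounded
      by \<open>\<eta> (Suc ?i)\<close> and hence by every coefficient of the current block.\<close>
    have "Suc k \<in> {M (Suc ?i)..<M (Suc (Suc ?i))}" using False idx(2)[of k] Mless[of "Suc ?i"] by auto
    then have "\<bar>C (\<pi> (Suc k))\<bar> \<le> \<eta> (Suc ?i)" using C\<pi> cbound pmem by metis
    also have "\<dots> \<le> \<bar>C (\<pi> k)\<bar>" using C\<pi>[OF idx_mem[of k]] enext[OF pmem[OF idx_mem[of k]]] by simp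
    finally show ?thesis .
  qed
  then have "greedy_ordering e x \<pi>" using bij by (simp add: greedy_ordering_def cfx)
  then have G: "(\<lambda>N. greedy_approx e \<pi> N x) \<longlonglongrightarrow> x" using qg by (simp add: quasi_greedy_def)
  have Minf: "filterlim M at_top sequentially" using filterlim_subseq[OF smono] .
  have MJinf: "filterlim (\<lambda>i. M i + J i) at_top sequentially"
    by (rule filterlim_at_top_mono[OF Minf]) simp
  \<comment> \<open>Both truncation points tend to infinity, so convergence forces this difference
    to 0; but it is the large greedy sum of block \<open>i\<close>.\<close>
  have "(\<lambda>i. greedy_approx e \<pi> (M i + J i) x - greedy_approx e \<pi> (M i) x) \<longlonglongrightarrow> x - x"
    by (intro tendsto_diff filterlim_compose[OF G] Minf MJinf)
  then have "(\<lambda>i. norm (greedy_approx e \<pi> (M i + J i) x - greedy_approx e \<pi> (M i) x)) \<longlonglongrightarrow> 0"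
    using tendsto_norm by fastforce
  moreover have "1 \<le> norm (greedy_approx e \<pi> (M i + J i) x - greedy_approx e \<pi> (M i) x)" for i
  proof -
    have "greedy_approx e \<pi> (M i + J i) x - greedy_approx e \<pi> (M i) x
        = (\<Sum>k\<in>{..<M i + J i} - {..<M i}. C (\<pi> k) *\<^sub>R e (\<pi> k))"
      unfolding greedy_approx_def cfx by (rule sum_diff[symmetric]) auto
    also have "{..<M i + J i} - {..<M i} = {M i..<M i + J i}" by auto
    also have "(\<Sum>k\<in>{M i..<M i + J i}. C (\<pi> k) *\<^sub>R e (\<pi> k))
        = (\<Sum>k\<in>{M i..<M i + J i}. c i (p i k) *\<^sub>R e (p i k))"
      using MJ[of i] C\<pi>[of _ i] \<pi>p[of _ i] by (intro sum.cong) auto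
    also have "\<dots> = lincomb (c i) (p i ` {M i..<M i + J i})"
    proof -
      have "inj_on (p i) {M i..<M i + J i}"
        using bij_betw_imp_inj_on[OF pbij[of i]] MJ[of i] by (elim inj_on_subset) auto
      then show ?thesis by (simp add: lincomb_def sum.reindex)
    qed
    finally show ?thesis using cbig[of i] by simp
  qed
  ultimately have "(1::real) \<le> 0" by (intro LIMSEQ_le_const) auto
  then show False by simp
qed

end

theorem theorem1:
  fixes e :: "nat \<Rightarrow> 'a::banach"
  assumes "schauder_basis e"
    and "seminormalized e"
    and "quasi_greedy e"
  shows "\<exists>C>0. \<forall>N\<ge>1. \<forall>x \<pi>. greedy_ordering e x \<pi> \<longrightarrow>
           norm (x - greedy_approx e \<pi> N x)
             \<le> C * 8 * qg_constant e ^ 5 * (\<Sum>k=1..N. mu e k * (1 / real k)) * sigma e N x"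
proof -
  interpret seminormalized_basis e using assms by unfold_locales
  show ?thesis using greedy_bounded_if_quasi_greedy[OF assms(3)] lebesgue_inequality by blast
qed

end
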